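(* Let $\mathcal{F}$ be a Fraïssé structure in a relational language such that $\mathrm{Age}(\mathcal{F})$ has the free joint embedding property, and let $G=\mathrm{Aut}(\mathcal{F})$ with the topology of pointwise convergence. Then every null $G$-flow has a fixed point. Equivalently, the universal minimal null flow $M_n(G)$ is a singleton.
   Context: A Fraïssé structure is a countable structure $\mathcal{F}$ in a relational language $\mathcal{L}$ which is ultrahomogeneous: every isomorphism between finite substructures of $\mathcal{F}$ extends to an automorphism of $\mathcal{F}$. $\mathrm{Age}(\mathcal{F})$ is the class of finite structures embeddable in $\mathcal{F}$. For $\mathcal{L}$-structures $A,B$, $A\sqcup B$ denotes the structure on the disjoint union of $A$ and $B$ in which a relation $R(c_1,\dots,c_n)$ holds iff all $c_i$ lie in $A$ and $R$ holds in $A$, or all $c_i$ lie in $B$ and $R$ holds in $B$. $\mathrm{Age}(\mathcal{F})$ has the free joint embedding property if $A\sqcup B\in\mathrm{Age}(\mathcal{F})$ whenever $A,B\in\mathrm{Age}(\mathcal{F})$. A $G$-flow is a compact Hausdorff space $X$ with a continuous action of $G$. For $A_0,A_1\subseteq X$, an independence set for $\{A_0,A_1\}$ is a set $I\subseteq G$ such that for every finite $J\subseteq I$ and every $\sigma\colon J\to\{0,1\}$, $\bigcap_{j\in J}j^{-1}A_{\sigma(j)}\neq\varnothing$. A pair $(x,y)\in X^2$ is an IN-pair if for every neighbourhoods $U_0\ni x$, $U_1\ni y$ and every $n\in\mathbb N$, $\{U_0,U_1\}$ has an independence set of size at least $n$. A $G$-flow $X$ is null if there is no continuous $f\colon X\to\mathbb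 R$ and IN-pair $(x,y)$ with $x\neq y$ and $f(x)\neq f(y)$ (equivalently, there is no IN-pair off the diagonal). $M_n(G)$ is the universal minimal null $G$-flow: a minimal null $G$-flow having every minimal null $G$-flow as an equivariant continuous image (it exists and is unique up to isomorphism). *)

theory Defs
  imports "HOL-Analysis.Analysis" "HOL-Algebra.Group_Action"
begin

section \<open>Relational structures\<close>

text \<open>The relation symbols form a set rather than a whole type, so that the empty language is
  included. Symbols outside this set are ignored everywhere.\<close>

record 'r language =
  syms :: "'r set"
  arity :: "'r \<Rightarrow> nat"

record ('a, 'r) relstruct = "'a partial_object" +
  rel :: "'r \<Rightarrow> 'a list set"

definition tuples :: "'r language \<Rightarrow> 'a set \<Rightarrow> 'r \<Rightarrow> 'a list set" where
  "tuples L S r = {xs. length xs = arity L r \<and> set xs \<subseteq> S}"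

definition is_structure :: "'r language \<Rightarrow> ('a, 'r) relstruct \<Rightarrow> bool" where
  "is_structure L A \<longleftrightarrow> (\<forall>r\<in>syms L. rel A r \<subseteq> tuples L (carrier A) r)"

definition embedding ::
  "'r language \<Rightarrow> ('a, 'r) relstruct \<Rightarrow> ('b, 'r) relstruct \<Rightarrow> ('a \<Rightarrow> 'b) \<Rightarrow> bool" where
  "embedding L A B f \<longleftrightarrow> f ` carrier A \<subseteq> carrier B \<and> inj_on f (carrier A) \<and>
     (\<forall>r\<in>syms L. \<forall>xs\<in>tuples L (carrier A) r. map f xs \<in> rel B r \<longleftrightarrow> xs \<in> rel A r)"

definition isomorphism ::
  "'r language \<Rightarrow> ('a, 'r) relstruct \<Rightarrow> ('b, 'r) relstruct \<Rightarrow> ('a \<Rightarrow> 'b) \<Rightarrow> bool" where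
  "isomorphism L A B f \<longleftrightarrow> embedding L A B f \<and> f ` carrier A = carrier B"

definition substructure_on :: "('a, 'r) relstruct \<Rightarrow> 'a set \<Rightarrow> ('a, 'r) relstruct" where
  "substructure_on F S = \<lparr>carrier = S, rel = (\<lambda>r. rel F r \<inter> {xs. set xs \<subseteq> S})\<rparr>"

definition disj_union :: "('a, 'r) relstruct \<Rightarrow> ('b, 'r) relstruct \<Rightarrow> ('a + 'b, 'r) relstruct" where
  "disj_union A B = \<lparr>carrier = carrier A <+> carrier B,
     rel = (\<lambda>r. map Inl ` rel A r \<union> map Inr ` rel B r)\<rparr>"

text \<open>As for all bijections in \<^const>\<open>BijGroup\<close>, automorphisms are
  normalised to be \<^const>\<open>undefined\<close> outside the carrier.\<close>

definition Aut :: "'r language \<Rightarrow> ('a, 'r) relstruct \<Rightarrow> ('a \<Rightarrow> 'a) monoid" where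
  "Aut L F = BijGroup (carrier F) \<lparr>carrier := {g \<in> Bij (carrier F). isomorphism L F F g}\<rparr>"

definition pointwise_topology :: "'r language \<Rightarrow> ('a, 'r) relstruct \<Rightarrow> ('a \<Rightarrow> 'a) topology" where
  "pointwise_topology L F =
     subtopology (product_topology (\<lambda>_. discrete_topology (carrier F)) (carrier F))
       (carrier (Aut L F))"

definition ultrahomogeneous :: "'r language \<Rightarrow> ('a, 'r) relstruct \<Rightarrow> bool" where
  "ultrahomogeneous L F \<longleftrightarrow>
     (\<forall>S T f. finite S \<and> S \<subseteq> carrier F \<and> finite T \<and> T \<subseteq> carrier F \<and>
        isomorphism L (substructure_on F S) (substructure_on F T) f \<longrightarrow>
        (\<exists>g\<in>carrier (Aut L F). \<forall>a\<in>S. g a = f a))"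

definition fraisse_structure :: "'r language \<Rightarrow> ('a, 'r) relstruct \<Rightarrow> bool" where
  "fraisse_structure L F \<longleftrightarrow>
     is_structure L F \<and> countable (carrier F) \<and> ultrahomogeneous L F"

definition age :: "'r language \<Rightarrow> ('a, 'r) relstruct \<Rightarrow> ('b, 'r) relstruct set" where
  "age L F = {A. is_structure L A \<and> finite (carrier A) \<and> (\<exists>f. embedding L A F f)}"

text \<open>Every finite structure is isomorphic to one whose elements are natural numbers, so it
  suffices to quantify over these; \<open>free_joint_embeddingD\<close> below covers the structures over
  arbitrary types.\<close>

definition free_joint_embedding :: "'r language \<Rightarrow> ('a, 'r) relstruct \<Rightarrow> bool" where
  "free_joint_embedding L F \<longleftrightarrow>
     (\<forall>A \<in> (age L F :: (nat, 'r) relstruct set). \<forall>B \<in> (age L F :: (nat, 'r) relstruct set).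
        disj_union A B \<in> age L F)"


section \<open>Flows\<close>

text \<open>A flow of the group \<open>G\<close>, topologised by \<open>T\<close>, is given by the space \<open>X\<close> and the
  action \<open>\<phi>\<close>. Flows are nonempty.\<close>

definition flow ::
  "('g, 'm) monoid_scheme \<Rightarrow> 'g topology \<Rightarrow> 'x topology \<Rightarrow> ('g \<Rightarrow> 'x \<Rightarrow> 'x) \<Rightarrow> bool" where
  "flow G T X \<phi> \<longleftrightarrow>
     topspace X \<noteq> {} \<and> compact_space X \<and> Hausdorff_space X \<and>
     group_action G (topspace X) \<phi> \<and>
     continuous_map (prod_topology T X) X (\<lambda>(g, x). \<phi> g x)"

text \<open>The choice \<open>\<sigma>\<close> takes the value \<^const>\<open>True\<close> for 1 and \<^const>\<open>False\<close> for 0. The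
  intersection over the empty index set is the whole space.\<close>

definition independence_set ::
  "('g, 'm) monoid_scheme \<Rightarrow> 'x topology \<Rightarrow> ('g \<Rightarrow> 'x \<Rightarrow> 'x) \<Rightarrow> 'x set \<Rightarrow> 'x set \<Rightarrow> 'g set \<Rightarrow> bool" where
  "independence_set G X \<phi> A0 A1 I \<longleftrightarrow> I \<subseteq> carrier G \<and>
     (\<forall>J \<sigma>. finite J \<and> J \<subseteq> I \<longrightarrow>
        topspace X \<inter> (\<Inter>j\<in>J. \<phi> (inv\<^bsub>G\<^esub> j) ` (if \<sigma> j then A1 else A0)) \<noteq> {})"

definition nbhd :: "'x topology \<Rightarrow> 'x \<Rightarrow> 'x set \<Rightarrow> bool" where
  "nbhd X x U \<longleftrightarrow> U \<subseteq> topspace X \<and> (\<exists>V. openin X V \<and> x \<in> V \<and> V \<subseteq> U)"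

definition IN_pair ::
  "('g, 'm) monoid_scheme \<Rightarrow> 'x topology \<Rightarrow> ('g \<Rightarrow> 'x \<Rightarrow> 'x) \<Rightarrow> 'x \<Rightarrow> 'x \<Rightarrow> bool" where
  "IN_pair G X \<phi> x y \<longleftrightarrow> x \<in> topspace X \<and> y \<in> topspace X \<and>
     (\<forall>U0 U1 n. nbhd X x U0 \<and> nbhd X y U1 \<longrightarrow>
        (\<exists>I. independence_set G X \<phi> U0 U1 I \<and> (infinite I \<or> n \<le> card I)))"

definition null_flow ::
  "('g, 'm) monoid_scheme \<Rightarrow> 'g topology \<Rightarrow> 'x topology \<Rightarrow> ('g \<Rightarrow> 'x \<Rightarrow> 'x) \<Rightarrow> bool" where
  "null_flow G T X \<phi> \<longleftrightarrow> flow G T X \<phi> \<and>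
     \<not> (\<exists>f x y. continuous_map X euclideanreal f \<and> IN_pair G X \<phi> x y \<and> x \<noteq> y \<and> f x \<noteq> f y)"

definition minimal_flow ::
  "('g, 'm) monoid_scheme \<Rightarrow> 'g topology \<Rightarrow> 'x topology \<Rightarrow> ('g \<Rightarrow> 'x \<Rightarrow> 'x) \<Rightarrow> bool" where
  "minimal_flow G T X \<phi> \<longleftrightarrow> flow G T X \<phi> \<and>
     (\<forall>C. closedin X C \<and> C \<noteq> {} \<and> (\<forall>g\<in>carrier G. \<phi> g ` C \<subseteq> C) \<longrightarrow> C = topspace X)"

definition minimal_null_flow ::
  "('g, 'm) monoid_scheme \<Rightarrow> 'g topology \<Rightarrow> 'x topology \<Rightarrow> ('g \<Rightarrow> 'x \<Rightarrow> 'x) \<Rightarrow> bool" where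
  "minimal_null_flow G T X \<phi> \<longleftrightarrow> minimal_flow G T X \<phi> \<and> null_flow G T X \<phi>"

definition flow_map ::
  "('g, 'm) monoid_scheme \<Rightarrow> 'x topology \<Rightarrow> ('g \<Rightarrow> 'x \<Rightarrow> 'x) \<Rightarrow>
   'y topology \<Rightarrow> ('g \<Rightarrow> 'y \<Rightarrow> 'y) \<Rightarrow> ('x \<Rightarrow> 'y) \<Rightarrow> bool" where
  "flow_map G X \<phi> Y \<psi> h \<longleftrightarrow> continuous_map X Y h \<and>
     (\<forall>g\<in>carrier G. \<forall>x\<in>topspace X. h (\<phi> g x) = \<psi> g (h x))"

text \<open>A definition cannot quantify over all types, so the competing flows live on the fixed type
  \<^typ>\<open>'g set set\<close>. It is large enough to hold a copy of every minimal flow of \<open>G\<close>: in a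
  minimal flow with base point \<open>p\<close>, a point \<open>x\<close> is determined by the family of all sets
  \<open>{g. g p \<in> U}\<close> for \<open>U\<close> an open neighbourhood of \<open>x\<close>. Hence the universal property holds
  for flows over all types; see \<open>universal_minimal_null_flowD\<close> below.\<close>

definition universal_minimal_null_flow ::
  "('g, 'm) monoid_scheme \<Rightarrow> 'g topology \<Rightarrow> 'x topology \<Rightarrow> ('g \<Rightarrow> 'x \<Rightarrow> 'x) \<Rightarrow> bool" where
  "universal_minimal_null_flow G T M \<phi> \<longleftrightarrow> minimal_null_flow G T M \<phi> \<and>
     (\<forall>(Y :: 'g set set topology) \<psi>. minimal_null_flow G T Y \<psi> \<longrightarrow>
        (\<exists>h. flow_map G M \<phi> Y \<psi> h \<and> h ` topspace M = topspace Y))"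


section \<open>Adequacy of the definitions\<close>

lemma map_in_tuples: "f ` S \<subseteq> S' \<Longrightarrow> xs \<in> tuples L S r \<Longrightarrow> map f xs \<in> tuples L S' r"
  by (auto simp: tuples_def)

lemma subgroup_Aut:
  "subgroup {g \<in> Bij (carrier F). isomorphism L F F g} (BijGroup (carrier F))"
  (is "subgroup ?H ?B")
proof (rule subgroup.intro)
  show "?H \<subseteq> carrier ?B"
    by (auto simp: BijGroup_def)
next
  fix x y assume x: "x \<in> ?H" and y: "y \<in> ?H"
  let ?S = "carrier F"
  have img: "compose ?S x y ` ?S \<subseteq> ?S" "inj_on (compose ?S x y) ?S" "compose ?S x y ` ?S = ?S"
    using compose_Bij[of x ?S y] x y by (auto simp: Bij_def bij_betw_def)
  have "map (compose ?S x y) xs \<in> rel F r \<longleftrightarrow> xs \<in> rel F r"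
    if r: "r \<in> syms L" and xs: "xs \<in> tuples L ?S r" for r xs
  proof -
    have "map (compose ?S x y) xs = map x (map y xs)"
      using xs by (auto simp: tuples_def compose_def)
    moreover have "map y xs \<in> tuples L ?S r"
      using xs y by (intro map_in_tuples[of y ?S]) (auto simp: isomorphism_def)
    moreover have "map x (map y xs) \<in> rel F r \<longleftrightarrow> map y xs \<in> rel F r"
      if "map y xs \<in> tuples L ?S r"
      using x r that unfolding isomorphism_def embedding_def by blast
    moreover have "map y xs \<in> rel F r \<longleftrightarrow> xs \<in> rel F r"
      using y r xs unfolding isomorphism_def embedding_def by blast
    ultimately show ?thesis
      by (simp del: map_map)
  qed
  hence "isomorphism L F F (compose ?S x y)"
    using img by (auto simp: isomorphism_def embedding_def)
  thus "x \<otimes>\<^bsub>?B\<^esub> y \<in> ?H"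
    using x y by (simp add: BijGroup_def compose_Bij)
next
  show "\<one>\<^bsub>?B\<^esub> \<in> ?H"
  proof -
    have "map (\<lambda>x\<in>carrier F. x) xs = xs" if "xs \<in> tuples L (carrier F) r" for xs r
      using that by (intro map_idI) (auto simp: tuples_def)
    thus ?thesis
      by (auto simp: BijGroup_def id_Bij isomorphism_def embedding_def inj_on_def)
  qed
next
  fix x assume x: "x \<in> ?H"
  let ?S = "carrier F" and ?y = "\<lambda>a\<in>carrier F. inv_into (carrier F) x a"
  have yB: "?y \<in> Bij ?S"
    using x restrict_inv_into_Bij by blast
  have "map ?y xs \<in> rel F r \<longleftrightarrow> xs \<in> rel F r"
    if r: "r \<in> syms L" and xs: "xs \<in> tuples L ?S r" for r xs
  proof -
    have t: "map ?y xs \<in> tuples L ?S r"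
      using xs yB by (intro map_in_tuples[of ?y ?S]) (auto simp: Bij_def bij_betw_def)
    have "map x (map ?y xs) = xs"
      using xs x by (auto simp: tuples_def Bij_def bij_betw_def f_inv_into_f intro!: map_idI)
    thus ?thesis
      using x r t by (metis (no_types, lifting) mem_Collect_eq isomorphism_def embedding_def)
  qed
  hence "isomorphism L F F ?y"
    using yB by (auto simp: isomorphism_def embedding_def Bij_def bij_betw_def)
  thus "inv\<^bsub>?B\<^esub> x \<in> ?H"
    using x yB by (simp add: inv_BijGroup)
qed

lemma group_Aut: "group (Aut L F)"
  using subgroup.subgroup_is_group[OF subgroup_Aut group_BijGroup] by (simp only: Aut_def)

lemma topspace_pointwise_topology: "topspace (pointwise_topology L F) = carrier (Aut L F)"
proof -
  have "carrier (Aut L F) \<subseteq> (\<Pi>\<^sub>E x\<in>carrier F. carrier F)"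
    by (auto simp: Aut_def PiE_def Bij_imp_extensional dest: Bij_imp_funcset)
  thus ?thesis
    by (auto simp: pointwise_topology_def)
qed

lemma embedding_trans:
  assumes "embedding L A B f" "embedding L B C g"
  shows "embedding L A C (g \<circ> f)"
proof -
  have "map (g \<circ> f) xs \<in> rel C r \<longleftrightarrow> xs \<in> rel A r"
    if "r \<in> syms L" "xs \<in> tuples L (carrier A) r" for r xs
    using that assms map_in_tuples[of f "carrier A" "carrier B" xs L r]
    unfolding embedding_def by (metis map_map)
  moreover have "inj_on (g \<circ> f) (carrier A)"
    using assms by (auto simp: embedding_def intro: comp_inj_on inj_on_subset)
  moreover have "(g \<circ> f) ` carrier A \<subseteq> carrier C"
    using assms by (auto simp: embedding_def)
  ultimately show ?thesis
    by (simp add: embedding_def)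
qed

lemma finite_structure_nat_copy:
  fixes A :: "('b, 'r) relstruct"
  assumes "is_structure L A" "finite (carrier A)"
  obtains A' :: "(nat, 'r) relstruct" and e where
    "is_structure L A'" "finite (carrier A')" "isomorphism L A A' e"
    "\<exists>e'. embedding L A' A e'"
proof -
  obtain e :: "'b \<Rightarrow> nat" where e: "inj_on e (carrier A)"
    using finite_imp_inj_to_nat_seg[OF assms(2)] by blast
  let ?i = "inv_into (carrier A) e"
  define A' :: "(nat, 'r) relstruct" where
    "A' = \<lparr>carrier = e ` carrier A, rel = (\<lambda>r. map e ` (rel A r \<inter> tuples L (carrier A) r))\<rparr>"
  have inv: "map ?i (map e xs) = xs" if "xs \<in> tuples L (carrier A) r" for xs r
    using that e by (auto simp: tuples_def intro!: map_idI)
  have eq: "map e xs \<in> rel A' r \<longleftrightarrow> xs \<in> rel A r"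
    if "xs \<in> tuples L (carrier A) r" for xs r
  proof
    assume "map e xs \<in> rel A' r"
    then obtain ys where ys: "ys \<in> rel A r" "ys \<in> tuples L (carrier A) r" "map e xs = map e ys"
      by (auto simp: A'_def)
    from ys(3) have "map ?i (map e xs) = map ?i (map e ys)" by (rule arg_cong)
    with ys(1) show "xs \<in> rel A r" by (simp only: inv[OF that] inv[OF ys(2)])
  qed (use that in \<open>auto simp: A'_def\<close>)
  show thesis
  proof (rule that)
    show "is_structure L A'"
      by (auto simp: is_structure_def A'_def tuples_def subset_iff)
    show "finite (carrier A')"
      using assms by (simp add: A'_def)
    show "isomorphism L A A' e"
      using e eq by (auto simp: isomorphism_def embedding_def A'_def)
    have "map ?i ys \<in> rel A r \<longleftrightarrow> ys \<in> rel A' r" if ys: "ys \<in> tuples L (carrier A') r" for ys r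
    proof -
      have t: "map ?i ys \<in> tuples L (carrier A) r"
        using ys by (intro map_in_tuples[of ?i "carrier A'"]) (auto simp: A'_def e)
      have "map e (map ?i ys) = ys"
        using ys by (auto simp: tuples_def A'_def f_inv_into_f intro!: map_idI)
      with eq[OF t] show ?thesis by simp
    qed
    hence "embedding L A' A ?i"
      using e unfolding embedding_def by (auto simp: A'_def inj_on_inv_into)
    thus "\<exists>e'. embedding L A' A e'" by blast
  qed
qed

lemma rel_disj_union:
  "xs \<in> rel (disj_union A B) r \<longleftrightarrow>
     (\<exists>ys\<in>rel A r. xs = map Inl ys) \<or> (\<exists>ys\<in>rel B r. xs = map Inr ys)"
  unfolding disj_union_def relstruct.select_convs by blast

lemma rel_embedding:
  assumes "embedding L A B f" "is_structure L A" "r \<in> syms L" "xs \<in> rel A r"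
  shows "map f xs \<in> rel B r"
  using assms unfolding embedding_def is_structure_def by blast

lemma map_map_sum_eq_map_Inl:
  assumes "map (map_sum f g) xs = map Inl zs"
  obtains ys where "xs = map Inl ys" "zs = map f ys"
  using assms
proof (induction xs arbitrary: zs thesis)
  case Nil
  show ?case
    by (rule Nil.prems(1)[of "[]"]) (use Nil.prems(2) in simp_all)
next
  case (Cons x xs)
  from Cons.prems(2) obtain z zs' where z: "zs = z # zs'" "map_sum f g x = Inl z"
    "map (map_sum f g) xs = map Inl zs'"
    by (cases zs) auto
  obtain ys where "xs = map Inl ys" "zs' = map f ys"
    using Cons.IH z(3) by blast
  moreover obtain y where "x = Inl y" "z = f y"
    using z(2) by (cases x) auto
  ultimately show ?case
    using Cons.prems(1)[of "y # ys"] z(1) by simp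
qed

lemma map_map_sum_eq_map_Inr:
  assumes "map (map_sum f g) xs = map Inr zs"
  obtains ys where "xs = map Inr ys" "zs = map g ys"
  using assms
proof (induction xs arbitrary: zs thesis)
  case Nil
  show ?case
    by (rule Nil.prems(1)[of "[]"]) (use Nil.prems(2) in simp_all)
next
  case (Cons x xs)
  from Cons.prems(2) obtain z zs' where z: "zs = z # zs'" "map_sum f g x = Inr z"
    "map (map_sum f g) xs = map Inr zs'"
    by (cases zs) auto
  obtain ys where "xs = map Inr ys" "zs' = map g ys"
    using Cons.IH z(3) by blast
  moreover obtain y where "x = Inr y" "z = g y"
    using z(2) by (cases x) auto
  ultimately show ?case
    using Cons.prems(1)[of "y # ys"] z(1) by simp
qed

lemma embedding_disj_union:
  assumes f: "embedding L A A' f" and g: "embedding L B B' g"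
    and A: "is_structure L A" and B: "is_structure L B"
  shows "embedding L (disj_union A B) (disj_union A' B') (map_sum f g)"
proof -
  let ?h = "map_sum f g"
  have "map ?h xs \<in> rel (disj_union A' B') r \<longleftrightarrow> xs \<in> rel (disj_union A B) r"
    if r: "r \<in> syms L" and xs: "xs \<in> tuples L (carrier A <+> carrier B) r" for r xs
  proof
    assume "xs \<in> rel (disj_union A B) r"
    then consider ys where "ys \<in> rel A r" "xs = map Inl ys"
      | ys where "ys \<in> rel B r" "xs = map Inr ys"
      unfolding rel_disj_union by blast
    thus "map ?h xs \<in> rel (disj_union A' B') r"
    proof cases
      case (1 ys)
      have "map ?h xs = map Inl (map f ys)" using 1(2) by simp
      thus ?thesis using rel_embedding[OF f A r 1(1)] unfolding rel_disj_union by blast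
    next
      case (2 ys)
      have "map ?h xs = map Inr (map g ys)" using 2(2) by simp
      thus ?thesis using rel_embedding[OF g B r 2(1)] unfolding rel_disj_union by blast
    qed
  next
    assume "map ?h xs \<in> rel (disj_union A' B') r"
    then consider zs where "zs \<in> rel A' r" "map ?h xs = map Inl zs"
      | zs where "zs \<in> rel B' r" "map ?h xs = map Inr zs"
      unfolding rel_disj_union by blast
    thus "xs \<in> rel (disj_union A B) r"
    proof cases
      case (1 zs)
      obtain ys where ys: "xs = map Inl ys" "zs = map f ys"
        using map_map_sum_eq_map_Inl[OF 1(2)] .
      have "ys \<in> tuples L (carrier A) r"
        using xs by (auto simp: ys(1) tuples_def)
      hence "ys \<in> rel A r"
        using f r 1(1) ys(2) by (simp add: embedding_def)
      thus ?thesis using ys(1) unfolding rel_disj_union by blast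
    next
      case (2 zs)
      obtain ys where ys: "xs = map Inr ys" "zs = map g ys"
        using map_map_sum_eq_map_Inr[OF 2(2)] .
      have "ys \<in> tuples L (carrier B) r"
        using xs by (auto simp: ys(1) tuples_def)
      hence "ys \<in> rel B r"
        using g r 2(1) ys(2) by (simp add: embedding_def)
      thus ?thesis using ys(1) unfolding rel_disj_union by blast
    qed
  qed
  moreover have "inj_on ?h (carrier A <+> carrier B)"
  proof -
    have "inj_on f (carrier A)" "inj_on g (carrier B)"
      using f g by (simp_all add: embedding_def)
    thus ?thesis
      by (intro inj_onI) (auto dest: inj_onD)
  qed
  moreover have "?h ` (carrier A <+> carrier B) \<subseteq> carrier A' <+> carrier B'"
  proof -
    have "f ` carrier A \<subseteq> carrier A'" "g ` carrier B \<subseteq> carrier B'"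
      using f g by (simp_all add: embedding_def)
    thus ?thesis
      by auto
  qed
  ultimately show ?thesis
    by (simp add: embedding_def disj_union_def)
qed

lemma is_structure_disj_union:
  assumes "is_structure L A" "is_structure L B"
  shows "is_structure L (disj_union A B)"
  unfolding is_structure_def
proof (intro ballI subsetI)
  fix r xs assume r: "r \<in> syms L" and "xs \<in> rel (disj_union A B) r"
  then consider ys where "ys \<in> tuples L (carrier A) r" "xs = map Inl ys"
    | ys where "ys \<in> tuples L (carrier B) r" "xs = map Inr ys"
    using assms unfolding rel_disj_union is_structure_def by blast
  thus "xs \<in> tuples L (carrier (disj_union A B)) r"
    by cases (auto simp: tuples_def disj_union_def)
qed

lemma free_joint_embeddingD:
  fixes F :: "('a, 'r) relstruct" and A :: "('b, 'r) relstruct" and B :: "('c, 'r) relstruct"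
  assumes F: "free_joint_embedding L F" and A: "A \<in> age L F" and B: "B \<in> age L F"
  shows "disj_union A B \<in> age L F"
proof -
  from A have A1: "is_structure L A" "finite (carrier A)" and "\<exists>f. embedding L A F f"
    by (auto simp: age_def)
  then obtain f where f: "embedding L A F f" by blast
  from B have B1: "is_structure L B" "finite (carrier B)" and "\<exists>f. embedding L B F f"
    by (auto simp: age_def)
  then obtain g where g: "embedding L B F g" by blast
  obtain A' :: "(nat, 'r) relstruct" and eA iA where A': "is_structure L A'" "finite (carrier A')"
    "isomorphism L A A' eA" "embedding L A' A iA"
    using finite_structure_nat_copy[OF A1] by metis
  obtain B' :: "(nat, 'r) relstruct" and eB iB where B': "is_structure L B'" "finite (carrier B')"
    "isomorphism L B B' eB" "embedding L B' B iB"
    using finite_structure_nat_copy[OF B1] by metis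
  have "A' \<in> age L F" "B' \<in> age L F"
    using A' B' embedding_trans[OF A'(4) f] embedding_trans[OF B'(4) g] by (auto simp: age_def)
  then obtain h where h: "embedding L (disj_union A' B') F h"
    using F unfolding free_joint_embedding_def age_def by blast
  have "embedding L (disj_union A B) (disj_union A' B') (map_sum eA eB)"
    using A' B' A1 B1 by (intro embedding_disj_union) (auto simp: isomorphism_def)
  from embedding_trans[OF this h] show ?thesis
    using A1 B1 is_structure_disj_union[OF A1(1) B1(1)]
    by (auto simp: age_def disj_union_def)
qed

lemma flow_act:
  assumes "flow G T X \<phi>" "g \<in> carrier G" "x \<in> topspace X"
  shows "\<phi> g x \<in> topspace X"
  using assms group_action.element_image unfolding flow_def by metis

lemma flow_act_mult:
  assumes "flow G T X \<phi>" "g \<in> carrier G" "h \<in> carrier G" "x \<in> topspace X"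
  shows "\<phi> (g \<otimes>\<^bsub>G\<^esub> h) x = \<phi> g (\<phi> h x)"
  using assms group_action.composition_rule unfolding flow_def by metis

lemma continuous_map_flow_act:
  assumes "flow G T X \<phi>" "topspace T = carrier G" "g \<in> carrier G"
  shows "continuous_map X X (\<phi> g)"
proof -
  have "continuous_map X (prod_topology T X) (\<lambda>x. (g, x))"
    using assms by (auto simp: continuous_map_pairwise o_def)
  moreover have "continuous_map (prod_topology T X) X (\<lambda>(g, x). \<phi> g x)"
    using assms by (simp add: flow_def)
  ultimately have "continuous_map X X ((\<lambda>(g, x). \<phi> g x) \<circ> (\<lambda>x. (g, x)))"
    by (rule continuous_map_compose)
  thus ?thesis by (simp add: o_def)
qed

lemma minimal_flow_dense_orbit:
  assumes min: "minimal_flow G T X \<phi>" and T: "topspace T = carrier G"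
    and p: "p \<in> topspace X" and U: "openin X U" "U \<noteq> {}"
  shows "\<exists>g\<in>carrier G. \<phi> g p \<in> U"
proof -
  have fl: "flow G T X \<phi>" using min by (simp add: minimal_flow_def)
  then interpret group_action G "topspace X" \<phi> by (simp add: flow_def)
  interpret group G using group_hom by (simp add: group_hom_def)
  let ?O = "(\<lambda>g. \<phi> g p) ` carrier G"
  let ?C = "X closure_of ?O"
  have sub: "?O \<subseteq> topspace X" using flow_act[OF fl _ p] by auto
  have "?O \<noteq> {}" by auto
  hence "?C \<noteq> {}" using closure_of_subset[OF sub] by auto
  moreover have "\<phi> g ` ?C \<subseteq> ?C" if g: "g \<in> carrier G" for g
  proof -
    have "\<phi> g ` ?C \<subseteq> X closure_of (\<phi> g ` ?O)"
      by (intro continuous_map_image_closure_subset continuous_map_flow_act[OF fl T g])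
    also have "\<phi> g ` ?O \<subseteq> ?O"
    proof safe
      fix h assume h: "h \<in> carrier G"
      have "\<phi> g (\<phi> h p) = \<phi> (g \<otimes>\<^bsub>G\<^esub> h) p" using flow_act_mult[OF fl g h p] by simp
      thus "\<phi> g (\<phi> h p) \<in> ?O" using g h by auto
    qed
    hence "X closure_of (\<phi> g ` ?O) \<subseteq> ?C" by (rule closure_of_mono)
    finally show ?thesis .
  qed
  ultimately have C: "?C = topspace X"
    using min[unfolded minimal_flow_def, THEN conjunct2, rule_format, of ?C] closedin_closure_of
    by blast
  obtain u where u: "u \<in> U" using U by blast
  have "u \<in> ?C" using C u openin_subset[OF U(1)] by blast
  hence "\<exists>y. y \<in> ?O \<and> y \<in> U"
    using u U(1) by (simp only: in_closure_of)
  thus ?thesis by blast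
qed

lemma minimal_flow_inj:
  fixes X :: "'x topology" and \<phi> :: "'g \<Rightarrow> 'x \<Rightarrow> 'x"
  assumes min: "minimal_flow G T X \<phi>" and T: "topspace T = carrier G"
  shows "\<exists>e :: 'x \<Rightarrow> 'g set set. inj_on e (topspace X)"
proof -
  have fl: "flow G T X \<phi>" using min by (simp add: minimal_flow_def)
  then obtain p where p: "p \<in> topspace X" unfolding flow_def by blast
  define V where "V U = {g \<in> carrier G. \<phi> g p \<in> U}" for U
  let ?e = "\<lambda>x. {V U | U. openin X U \<and> x \<in> U}"
  have "x = y" if x: "x \<in> topspace X" and y: "y \<in> topspace X" and eq: "?e x = ?e y" for x y
  proof (rule ccontr)
    assume "x \<noteq> y"
    then obtain U W where UW: "openin X U" "openin X W" "x \<in> U" "y \<in> W" "disjnt U W"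
      using fl x y unfolding flow_def Hausdorff_space_def by blast
    hence "V U \<in> ?e x" by blast
    hence "V U \<in> ?e y" using eq by simp
    then obtain U' where U': "openin X U'" "y \<in> U'" "V U = V U'" by blast
    have "openin X (U' \<inter> W)" "U' \<inter> W \<noteq> {}" using U' UW by auto
    from minimal_flow_dense_orbit[OF min T p this]
    obtain g where g: "g \<in> carrier G" "\<phi> g p \<in> U'" "\<phi> g p \<in> W" by blast
    hence "g \<in> V U'" by (simp add: V_def)
    hence "g \<in> V U" by (simp only: U'(3))
    with g UW(5) show False by (auto simp: V_def disjnt_iff)
  qed
  hence "inj_on ?e (topspace X)" by (rule inj_onI)
  thus ?thesis by blast
qed

lemma group_action_transport:
  assumes "group_action G E \<phi>" and bij: "bij_betw e E E'" and i: "\<And>x. x \<in> E \<Longrightarrow> i (e x) = x"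
  shows "group_action G E' (\<lambda>g. \<lambda>y\<in>E'. e (\<phi> g (i y)))" (is "group_action G E' ?\<psi>")
proof -
  interpret group_action G E \<phi> by fact
  interpret group G using group_hom by (simp add: group_hom_def)
  have iE: "i y \<in> E" "e (i y) = y" if "y \<in> E'" for y
    using that bij i by (auto simp: bij_betw_def)
  have bij_i: "bij_betw i E' E"
    using bij i iE by (intro bij_betwI[of _ _ _ e]) (auto simp: bij_betw_def)
  have \<psi>: "?\<psi> g \<in> Bij E'" if g: "g \<in> carrier G" for g
  proof -
    have "bij_betw (\<phi> g) E E" using bij_prop0[OF g] by (simp add: Bij_def)
    hence "bij_betw (e \<circ> (\<phi> g \<circ> i)) E' E'"
      using bij bij_i by (blast intro: bij_betw_trans)
    hence "bij_betw (?\<psi> g) E' E'"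
      by (rule iffD1[OF bij_betw_cong, rotated]) simp
    thus ?thesis by (simp add: Bij_def)
  qed
  have "?\<psi> (g \<otimes>\<^bsub>G\<^esub> h) = compose E' (?\<psi> g) (?\<psi> h)"
    if g: "g \<in> carrier G" and h: "h \<in> carrier G" for g h
  proof (rule extensionalityI[of _ E'])
    fix y assume y: "y \<in> E'"
    have hy: "\<phi> h (i y) \<in> E" using element_image[OF h iE(1)[OF y] refl] .
    have "e (\<phi> h (i y)) \<in> E'" using bij hy by (auto simp: bij_betw_def)
    moreover have "\<phi> (g \<otimes>\<^bsub>G\<^esub> h) (i y) = \<phi> g (\<phi> h (i y))"
      using composition_rule[OF iE(1)[OF y] g h] .
    ultimately show "?\<psi> (g \<otimes>\<^bsub>G\<^esub> h) y = compose E' (?\<psi> g) (?\<psi> h) y"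
      using y by (simp add: compose_def i[OF hy])
  qed (auto simp: compose_def)
  hence "?\<psi> \<in> hom G (BijGroup E')"
    using \<psi> by (auto simp: hom_def BijGroup_def)
  thus ?thesis
    by (intro group_action.intro group_hom.intro group_hom_axioms.intro group_BijGroup is_group)
qed

lemma minimal_null_flow_transport:
  fixes X :: "'x topology" and Y :: "'y topology"
  assumes mn: "minimal_null_flow G T X \<phi>" and hm: "homeomorphic_maps X Y e i"
  defines "\<psi> \<equiv> \<lambda>g. \<lambda>y\<in>topspace Y. e (\<phi> g (i y))"
  shows "minimal_null_flow G T Y \<psi> \<and> flow_map G Y \<psi> X \<phi> i"
proof -
  have fl: "flow G T X \<phi>" and min: "minimal_flow G T X \<phi>" and null: "null_flow G T X \<phi>"
    using mn by (simp_all add: minimal_null_flow_def minimal_flow_def)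
  interpret group_action G "topspace X" \<phi> using fl by (simp add: flow_def)
  interpret group G using group_hom by (simp add: group_hom_def)
  have ce: "continuous_map X Y e" and ci: "continuous_map Y X i"
    and ie: "\<And>x. x \<in> topspace X \<Longrightarrow> i (e x) = x"
    and ei: "\<And>y. y \<in> topspace Y \<Longrightarrow> e (i y) = y"
    using hm by (auto simp: homeomorphic_maps_def)
  have hme: "homeomorphic_map X Y e" and hmi: "homeomorphic_map Y X i"
    using hm homeomorphic_maps_map by blast+
  have eY: "\<And>x. x \<in> topspace X \<Longrightarrow> e x \<in> topspace Y"
    and iX: "\<And>y. y \<in> topspace Y \<Longrightarrow> i y \<in> topspace X"
    using ce ci by (auto simp: continuous_map_def)
  have bij: "bij_betw e (topspace X) (topspace Y)"
    by (rule bij_betwI[of _ _ _ i]) (auto simp: ie ei eY iX)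
  have act: "\<phi> g x \<in> topspace X" if "g \<in> carrier G" "x \<in> topspace X" for g x
    using flow_act[OF fl] that by blast
  have \<psi>: "\<psi> g y = e (\<phi> g (i y))" if "y \<in> topspace Y" for g y
    using that by (simp add: \<psi>_def)
  have eq: "i (\<psi> g y) = \<phi> g (i y)" if "g \<in> carrier G" "y \<in> topspace Y" for g y
    using that by (simp add: \<psi> ie act iX)
  have \<psi>e: "\<psi> g (e x) = e (\<phi> g x)" if "x \<in> topspace X" for g x
    using that by (simp add: \<psi> ie eY)
  have XY: "X homeomorphic_space Y"
    using hm homeomorphic_space_def by blast
  have "group_action G (topspace Y) \<psi>"
    unfolding \<psi>_def using group_action_transport[OF _ bij ie] group_action_axioms by blast
  moreover have "compact_space Y" "Hausdorff_space Y"
    using fl homeomorphic_compact_space[OF XY] homeomorphic_Hausdorff_space[OF XY]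
    by (simp_all add: flow_def)
  moreover have "topspace Y \<noteq> {}"
    using fl eY by (fastforce simp: flow_def)
  moreover have "continuous_map (prod_topology T Y) Y (\<lambda>(g, y). \<psi> g y)"
  proof -
    have "continuous_map (prod_topology T Y) (prod_topology T X) (\<lambda>z. (fst z, i (snd z)))"
      using continuous_map_compose[OF continuous_map_snd ci]
      by (intro continuous_map_pairedI continuous_map_fst) (auto simp: o_def)
    moreover have "continuous_map (prod_topology T X) X (\<lambda>(g, x). \<phi> g x)"
      using fl by (simp add: flow_def)
    ultimately have "continuous_map (prod_topology T Y) Y
        (e \<circ> ((\<lambda>(g, x). \<phi> g x) \<circ> (\<lambda>z. (fst z, i (snd z)))))"
      by (intro continuous_map_compose[OF _ ce] continuous_map_compose)
    thus ?thesis
      by (rule continuous_map_eq) (auto simp: \<psi>)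
  qed
  ultimately have flY: "flow G T Y \<psi>"
    by (simp add: flow_def)
  have "C = topspace Y"
    if C: "closedin Y C" "C \<noteq> {}" and inv: "\<And>g. g \<in> carrier G \<Longrightarrow> \<psi> g ` C \<subseteq> C" for C
  proof -
    have CY: "C \<subseteq> topspace Y" using C closedin_subset by blast
    have "closedin X (i ` C)"
      using homeomorphic_map_closedness[OF hmi CY] C by blast
    moreover have "\<phi> g ` (i ` C) \<subseteq> i ` C" if g: "g \<in> carrier G" for g
    proof safe
      fix y assume y: "y \<in> C"
      have "\<phi> g (i y) = i (\<psi> g y)" using eq[OF g] y CY by auto
      thus "\<phi> g (i y) \<in> i ` C" using inv[OF g] y by auto
    qed
    moreover have "i ` C \<noteq> {}" using C by simp
    ultimately have "i ` C = topspace X"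
      using min[unfolded minimal_flow_def, THEN conjunct2, rule_format, of "i ` C"] by blast
    hence "e ` i ` C = topspace Y"
      using bij by (simp add: bij_betw_def)
    moreover have "e ` i ` C = C"
      using CY ei by (force simp: image_image)
    ultimately show ?thesis by simp
  qed
  hence minY: "minimal_flow G T Y \<psi>"
    using flY by (simp add: minimal_flow_def)
  have nb: "nbhd Y y (e ` U)" if y: "y \<in> topspace Y" and U: "nbhd X (i y) U" for y U
  proof -
    from U obtain V where V: "U \<subseteq> topspace X" "openin X V" "i y \<in> V" "V \<subseteq> U"
      by (auto simp: nbhd_def)
    have "openin Y (e ` V)"
      using homeomorphic_map_openness[OF hme, of V] V by auto
    moreover have "y \<in> e ` V" using V(3) ei[OF y] by force
    ultimately show ?thesis
      using V eY unfolding nbhd_def by (intro conjI exI[of _ "e ` V"]) auto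
  qed
  have ind: "independence_set G X \<phi> U0 U1 I"
    if I: "independence_set G Y \<psi> (e ` U0) (e ` U1) I"
      and U: "U0 \<subseteq> topspace X" "U1 \<subseteq> topspace X" for U0 U1 I
    unfolding independence_set_def
  proof (intro conjI allI impI)
    show IG: "I \<subseteq> carrier G" using I by (simp add: independence_set_def)
    fix J \<sigma> assume J: "finite J \<and> J \<subseteq> I"
    with I have "topspace Y \<inter> (\<Inter>j\<in>J. \<psi> (inv\<^bsub>G\<^esub> j) ` (if \<sigma> j then e ` U1 else e ` U0)) \<noteq> {}"
      unfolding independence_set_def by (elim conjE allE[of _ J] allE[of _ \<sigma>] impE) auto
    then obtain y where y: "y \<in> topspace Y"
      and y': "y \<in> (\<Inter>j\<in>J. \<psi> (inv\<^bsub>G\<^esub> j) ` (if \<sigma> j then e ` U1 else e ` U0))"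
      by blast
    have yj: "y \<in> \<psi> (inv\<^bsub>G\<^esub> j) ` (if \<sigma> j then e ` U1 else e ` U0)" if "j \<in> J" for j
      using y' that by (rule INT_D)
    have "i y \<in> \<phi> (inv\<^bsub>G\<^esub> j) ` (if \<sigma> j then U1 else U0)" if j: "j \<in> J" for j
    proof -
      let ?U = "if \<sigma> j then U1 else U0"
      have "y \<in> \<psi> (inv\<^bsub>G\<^esub> j) ` e ` ?U" using yj[OF j] by (simp split: if_splits)
      then obtain x where x: "x \<in> ?U" "y = \<psi> (inv\<^bsub>G\<^esub> j) (e x)" by blast
      have "x \<in> topspace X" using x(1) U by (auto split: if_splits)
      hence "i y = \<phi> (inv\<^bsub>G\<^esub> j) x"
        using x(2) j J IG by (simp add: \<psi>e ie act subset_iff)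
      thus ?thesis using x(1) by blast
    qed
    thus "topspace X \<inter> (\<Inter>j\<in>J. \<phi> (inv\<^bsub>G\<^esub> j) ` (if \<sigma> j then U1 else U0)) \<noteq> {}"
      using iX[OF y] by blast
  qed
  have IN: "IN_pair G X \<phi> (i x) (i y)" if xy: "IN_pair G Y \<psi> x y" for x y
    unfolding IN_pair_def
  proof (intro conjI allI impI)
    have x: "x \<in> topspace Y" and y: "y \<in> topspace Y" using xy by (simp_all add: IN_pair_def)
    show "i x \<in> topspace X" "i y \<in> topspace X" using x y iX by auto
    fix U0 U1 n assume U: "nbhd X (i x) U0 \<and> nbhd X (i y) U1"
    then obtain I where "independence_set G Y \<psi> (e ` U0) (e ` U1) I" "infinite I \<or> n \<le> card I"
      using xy nb[OF x] nb[OF y] unfolding IN_pair_def by meson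
    thus "\<exists>I. independence_set G X \<phi> U0 U1 I \<and> (infinite I \<or> n \<le> card I)"
      using ind U unfolding nbhd_def by blast
  qed
  have False
    if f: "continuous_map Y euclideanreal f" and xy: "IN_pair G Y \<psi> x y" "f x \<noteq> f y" for f x y
  proof -
    have "x \<in> topspace Y" "y \<in> topspace Y" using xy by (simp_all add: IN_pair_def)
    hence "(f \<circ> e) (i x) \<noteq> (f \<circ> e) (i y)" "i x \<noteq> i y"
      using xy ei by (auto, metis)
    moreover have "continuous_map X euclideanreal (f \<circ> e)"
      by (rule continuous_map_compose[OF ce f])
    ultimately show False
      using null IN[OF xy(1)] unfolding null_flow_def by blast
  qed
  hence "null_flow G T Y \<psi>"
    using flY unfolding null_flow_def by blast
  thus ?thesis
    using minY ci eq by (simp add: minimal_null_flow_def flow_map_def)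
qed

lemma universal_minimal_null_flowD:
  fixes M :: "'x topology" and Y :: "'y topology"
  assumes T: "topspace T = carrier G"
    and univ: "universal_minimal_null_flow G T M \<phi>" and Y: "minimal_null_flow G T Y \<psi>"
  shows "\<exists>h. flow_map G M \<phi> Y \<psi> h \<and> h ` topspace M = topspace Y"
proof -
  let ?S = "topspace Y"
  have "minimal_flow G T Y \<psi>" using Y by (simp add: minimal_null_flow_def)
  from minimal_flow_inj[OF this T] obtain e :: "'y \<Rightarrow> 'a set set" where e: "inj_on e ?S" ..
  let ?i = "inv_into ?S e"
  define Z where "Z = pullback_topology (e ` ?S) ?i Y"
  have tZ: "topspace Z = e ` ?S"
    using e by (auto simp: Z_def topspace_pullback_topology)
  have ci: "continuous_map Z Y ?i"
    using continuous_map_pullback[of Y Y id "e ` ?S" ?i] by (simp add: Z_def)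
  have "continuous_map Y Y (?i \<circ> e)"
    by (rule continuous_map_eq[of Y Y "\<lambda>x. x"]) (simp_all add: inv_into_f_f[OF e])
  hence ce: "continuous_map Y Z e"
    unfolding Z_def by (rule continuous_map_pullback') blast
  have hm: "homeomorphic_maps Y Z e ?i"
    unfolding homeomorphic_maps_def tZ
    by (intro conjI ballI ce ci) (auto simp: inv_into_f_f[OF e])
  define \<zeta> where "\<zeta> = (\<lambda>g. \<lambda>z\<in>topspace Z. e (\<psi> g (?i z)))"
  have "minimal_null_flow G T Z \<zeta>" and iZ: "flow_map G Z \<zeta> Y \<psi> ?i"
    using minimal_null_flow_transport[OF Y hm] by (simp_all add: \<zeta>_def)
  with univ obtain h where h: "flow_map G M \<phi> Z \<zeta> h" "h ` topspace M = topspace Z"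
    unfolding universal_minimal_null_flow_def by blast
  have "continuous_map M Y (?i \<circ> h)"
    using h(1) unfolding flow_map_def by (intro continuous_map_compose[OF _ ci]) blast
  moreover have "h x \<in> topspace Z" if "x \<in> topspace M" for x
    using h(2) that by blast
  ultimately have "flow_map G M \<phi> Y \<psi> (?i \<circ> h)"
    using h(1) iZ by (simp add: flow_map_def)
  moreover have "(?i \<circ> h) ` topspace M = ?S"
    using h(2) inv_into_image_cancel[OF e order_refl] by (simp only: image_comp [symmetric] tZ)
  ultimately show ?thesis by blast
qed

end

theory Submission
  imports Defs
begin

text \<open>Suppose a null flow \<open>X\<close> of \<open>G = Aut(F)\<close> has no fixed point. Every point \<open>y\<close> is moved by
  some \<open>g\<^sub>y\<close>, and \<open>(y, g\<^sub>y y)\<close> is not an IN-pair, so it has neighbourhoods \<open>U\<^sub>y\<close>, \<open>V\<^sub>y\<close> without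
  infinite independence sets. By continuity there are a finite \<open>A\<^sub>y \<subseteq> F\<close> and an open \<open>W\<^sub>y \<ni> y\<close> such
  that \<open>v w \<in> U\<^sub>y\<close> and \<open>v g\<^sub>y w \<in> V\<^sub>y\<close> whenever \<open>w \<in> W\<^sub>y\<close> and \<open>v\<close> fixes \<open>A\<^sub>y\<close> pointwise.
  Finitely many \<open>W\<^sub>y\<close> cover \<open>X\<close>; let \<open>A\<close> be the union of the corresponding \<open>A\<^sub>y\<close> and let the finite
  set \<open>B\<close> contain \<open>A\<close> and all \<open>g\<^sub>y\<^sup>-\<^sup>1 A\<close>. Free joint embedding and homogeneity give
  \<open>h\<^sub>0, h\<^sub>1, \<dots> \<in> G\<close> such that the sets \<open>h\<^sub>k B\<close> are disjoint with no relations across them. Fix \<open>x\<close>;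
  some \<open>W\<^sub>y\<close> contains \<open>h\<^sub>k\<^sup>-\<^sup>1 x\<close> for infinitely many \<open>k\<close>. For any choice of \<open>z\<^sub>k \<in> {1, g\<^sub>y}\<close> for finitely
  many of these \<open>k\<close>, homogeneity gives one automorphism \<open>p\<close> agreeing with \<open>h\<^sub>k z\<^sub>k\<^sup>-\<^sup>1 h\<^sub>k\<^sup>-\<^sup>1\<close> on each
  \<open>h\<^sub>k A\<close>. Then \<open>h\<^sub>k\<^sup>-\<^sup>1 p\<^sup>-\<^sup>1 x = v z\<^sub>k h\<^sub>k\<^sup>-\<^sup>1 x\<close> with \<open>v\<close> fixing \<open>A\<close>, so the \<open>h\<^sub>k\<^sup>-\<^sup>1\<close> form an infinite
  independence set for \<open>U\<^sub>y\<close>, \<open>V\<^sub>y\<close>, a contradiction.\<close>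

section \<open>Automorphisms\<close>

lemma Aut_mult: "g \<in> carrier (Aut L F) \<Longrightarrow> h \<in> carrier (Aut L F) \<Longrightarrow> a \<in> carrier F \<Longrightarrow>
    (g \<otimes>\<^bsub>Aut L F\<^esub> h) a = g (h a)"
  by (simp add: Aut_def BijGroup_def compose_def)

lemma Aut_one: "a \<in> carrier F \<Longrightarrow> \<one>\<^bsub>Aut L F\<^esub> a = a"
  by (simp add: Aut_def BijGroup_def)

lemma Aut_isomorphism: "g \<in> carrier (Aut L F) \<Longrightarrow> isomorphism L F F g"
  by (simp add: Aut_def)

lemma Aut_closed: "g \<in> carrier (Aut L F) \<Longrightarrow> a \<in> carrier F \<Longrightarrow> g a \<in> carrier F"
  using Aut_isomorphism[of g L F] by (auto simp: isomorphism_def)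

lemma Aut_inj: "g \<in> carrier (Aut L F) \<Longrightarrow> inj_on g (carrier F)"
  using Aut_isomorphism[of g L F] by (auto simp: isomorphism_def embedding_def)

lemma Aut_inv_closed: "g \<in> carrier (Aut L F) \<Longrightarrow> inv\<^bsub>Aut L F\<^esub> g \<in> carrier (Aut L F)"
  by (rule group.inv_closed[OF group_Aut])

lemma Aut_mult_closed: "g \<in> carrier (Aut L F) \<Longrightarrow> h \<in> carrier (Aut L F) \<Longrightarrow>
    g \<otimes>\<^bsub>Aut L F\<^esub> h \<in> carrier (Aut L F)"
  by (rule monoid.m_closed[OF group.is_monoid[OF group_Aut]])

lemma Aut_inv_apply: "g \<in> carrier (Aut L F) \<Longrightarrow> a \<in> carrier F \<Longrightarrow> (inv\<^bsub>Aut L F\<^esub> g) (g a) = a"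
  by (metis Aut_inv_closed Aut_mult Aut_one group.l_inv group_Aut)

lemma Aut_apply_inv: "g \<in> carrier (Aut L F) \<Longrightarrow> a \<in> carrier F \<Longrightarrow> g ((inv\<^bsub>Aut L F\<^esub> g) a) = a"
  by (metis Aut_inv_closed Aut_mult Aut_one group.r_inv group_Aut)

lemma rel_set_subset:
  "is_structure L F \<Longrightarrow> r \<in> syms L \<Longrightarrow> xs \<in> rel F r \<Longrightarrow> set xs \<subseteq> carrier F"
  by (auto simp: is_structure_def tuples_def)

lemma Aut_rel:
  assumes "is_structure L F" "g \<in> carrier (Aut L F)" "r \<in> syms L" "set xs \<subseteq> carrier F"
  shows "map g xs \<in> rel F r \<longleftrightarrow> xs \<in> rel F r"
proof (cases "length xs = arity L r")
  case True
  thus ?thesis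
    using Aut_isomorphism[OF assms(2)] assms
    by (auto simp: isomorphism_def embedding_def tuples_def)
next
  case False
  have "length ys = arity L r" if "ys \<in> rel F r" for ys
    using assms(1,3) that by (auto simp: is_structure_def tuples_def)
  from this[of "map g xs"] this[of xs] False have "map g xs \<notin> rel F r" "xs \<notin> rel F r"
    by auto
  thus ?thesis by simp
qed

text \<open>A basic open set of the product restricts only finitely many coordinates; these form
  \<open>A\<close>.\<close>

lemma pointwise_topology_nbhd_one:
  assumes "openin (pointwise_topology L F) V" "\<one>\<^bsub>Aut L F\<^esub> \<in> V"
  obtains A where "finite A" "A \<subseteq> carrier F"
    "\<And>v. v \<in> carrier (Aut L F) \<Longrightarrow> (\<And>a. a \<in> A \<Longrightarrow> v a = a) \<Longrightarrow> v \<in> V"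
proof -
  let ?P = "product_topology (\<lambda>_. discrete_topology (carrier F)) (carrier F)"
  obtain W where W: "openin ?P W" "V = W \<inter> carrier (Aut L F)"
    using assms(1) unfolding pointwise_topology_def openin_subtopology by blast
  obtain U where U: "finite {i \<in> carrier F. U i \<noteq> carrier F}"
      "\<one>\<^bsub>Aut L F\<^esub> \<in> Pi\<^sub>E (carrier F) U" "Pi\<^sub>E (carrier F) U \<subseteq> W"
    using W(1) assms(2) unfolding W(2) openin_product_topology_alt by auto
  let ?A = "{i \<in> carrier F. U i \<noteq> carrier F}"
  show thesis
  proof (rule that[of ?A])
    fix v assume v: "v \<in> carrier (Aut L F)" and fix_A: "\<And>a. a \<in> ?A \<Longrightarrow> v a = a"
    have "v a \<in> U a" if a: "a \<in> carrier F" for a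
    proof (cases "a \<in> ?A")
      case True
      have "\<one>\<^bsub>Aut L F\<^esub> a \<in> U a" using U(2) a by blast
      thus ?thesis using fix_A[OF True] Aut_one[OF a, of L] by simp
    next
      case False
      thus ?thesis using a Aut_closed[OF v a] by auto
    qed
    moreover have "v \<in> extensional (carrier F)"
      using v by (auto simp: Aut_def Bij_def)
    ultimately have "v \<in> Pi\<^sub>E (carrier F) U" by (simp add: PiE_def)
    thus "v \<in> V" using U(3) v W(2) by blast
  qed (use U(1) in auto)
qed


section \<open>Free copies of finite substructures\<close>

text \<open>The empty tuple is exempted because a nullary relation that holds in \<open>F\<close> holds even when \<open>J\<close> is
  empty.\<close>

definition free_family ::
  "'r language \<Rightarrow> ('a, 'r) relstruct \<Rightarrow> ('i \<Rightarrow> 'a set) \<Rightarrow> 'i set \<Rightarrow> bool" where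
  "free_family L F C J \<longleftrightarrow> disjoint_family_on C J \<and>
     (\<forall>r\<in>syms L. \<forall>xs\<in>rel F r. set xs \<subseteq> (\<Union>k\<in>J. C k) \<longrightarrow> xs = [] \<or> (\<exists>k\<in>J. set xs \<subseteq> C k))"

lemma free_familyD:
  assumes "free_family L F C J"
  shows "k \<in> J \<Longrightarrow> l \<in> J \<Longrightarrow> a \<in> C k \<Longrightarrow> a \<in> C l \<Longrightarrow> k = l"
    and "r \<in> syms L \<Longrightarrow> xs \<in> rel F r \<Longrightarrow> set xs \<subseteq> (\<Union>k\<in>J. C k) \<Longrightarrow>
      xs = [] \<or> (\<exists>k\<in>J. set xs \<subseteq> C k)"
proof -
  show "k \<in> J \<Longrightarrow> l \<in> J \<Longrightarrow> a \<in> C k \<Longrightarrow> a \<in> C l \<Longrightarrow> k = l"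
    using assms unfolding free_family_def disjoint_family_on_def by (meson disjoint_iff)
qed (use assms in \<open>simp add: free_family_def\<close>)

text \<open>The head of a nonempty related tuple lies in a block indexed by \<open>J'\<close>, and
  disjointness makes this the block that contains the whole tuple.\<close>

lemma free_family_mono:
  assumes "free_family L F C J" "J' \<subseteq> J"
  shows "free_family L F C J'"
  unfolding free_family_def
proof (intro conjI ballI impI)
  show "disjoint_family_on C J'"
    using assms(1) disjoint_family_on_mono[OF assms(2), of C] by (simp add: free_family_def)
  fix r xs assume r: "r \<in> syms L" "xs \<in> rel F r" and xs: "set xs \<subseteq> (\<Union>k\<in>J'. C k)"
  have "set xs \<subseteq> (\<Union>k\<in>J. C k)" using xs assms(2) by (meson UN_mono order_refl order_trans)
  then consider "xs = []" | k where "k \<in> J" "set xs \<subseteq> C k" "xs \<noteq> []"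
    using free_familyD(2)[OF assms(1) r] by blast
  thus "xs = [] \<or> (\<exists>k\<in>J'. set xs \<subseteq> C k)"
  proof cases
    case (2 k)
    have "hd xs \<in> set xs" using 2(3) by simp
    then obtain l where l: "l \<in> J'" "hd xs \<in> C l" "hd xs \<in> C k" using xs 2(2) by blast
    have "k = l"
      using free_familyD(1)[OF assms(1) 2(1) _ l(3,2)] l(1) assms(2) by blast
    thus ?thesis using l(1) 2(2) by blast
  qed simp
qed

section \<open>Homogeneity and free copies\<close>

lemma substructure_on_in_age:
  assumes "is_structure L F" "finite S" "S \<subseteq> carrier F"
  shows "substructure_on F S \<in> age L F"
proof -
  have "is_structure L (substructure_on F S)"
    using assms(1) by (auto simp: is_structure_def substructure_on_def tuples_def subset_iff)
  moreover have "embedding L (substructure_on F S) F (\<lambda>x. x)"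
    using assms(3) by (auto simp: embedding_def substructure_on_def tuples_def)
  ultimately show ?thesis
    using assms(2) by (auto simp: age_def substructure_on_def)
qed

lemma partial_embedding_extends:
  assumes F: "ultrahomogeneous L F" and S: "finite S" "S \<subseteq> carrier F"
    and f: "f ` S \<subseteq> carrier F" "inj_on f S"
    and rel: "\<And>r xs. r \<in> syms L \<Longrightarrow> set xs \<subseteq> S \<Longrightarrow> length xs = arity L r \<Longrightarrow>
      map f xs \<in> rel F r \<longleftrightarrow> xs \<in> rel F r"
  obtains g where "g \<in> carrier (Aut L F)" "\<And>a. a \<in> S \<Longrightarrow> g a = f a"
proof -
  have "isomorphism L (substructure_on F S) (substructure_on F (f ` S)) f"
    using f(2) rel by (auto simp: isomorphism_def embedding_def substructure_on_def tuples_def)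
  moreover have "finite (f ` S)" using S(1) by simp
  ultimately have "\<exists>g\<in>carrier (Aut L F). \<forall>a\<in>S. g a = f a"
    using F S f(1) unfolding ultrahomogeneous_def by blast
  thus thesis using that by blast
qed

text \<open>An embedding \<open>e\<close> of the disjoint union places \<open>D\<close> and
  \<open>B\<close> freely somewhere in \<open>F\<close>. Homogeneity gives \<open>g\<close> and
  \<open>k\<close> that agree with \<open>e\<close> on the two summands, and undoing
  \<open>g\<close> returns the copy of \<open>D\<close> to \<open>D\<close> itself.\<close>

lemma free_copy:
  assumes F: "fraisse_structure L F" and fj: "free_joint_embedding L F"
    and D: "finite D" "D \<subseteq> carrier F" and B: "finite B" "B \<subseteq> carrier F"
  obtains h where "h \<in> carrier (Aut L F)" "D \<inter> h ` B = {}"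
    "\<And>r xs. r \<in> syms L \<Longrightarrow> xs \<in> rel F r \<Longrightarrow> set xs \<subseteq> D \<union> h ` B \<Longrightarrow> set xs \<subseteq> D \<or> set xs \<subseteq> h ` B"
proof -
  have st: "is_structure L F" and uh: "ultrahomogeneous L F"
    using F by (simp_all add: fraisse_structure_def)
  let ?U = "disj_union (substructure_on F D) (substructure_on F B)"
  obtain e where e: "embedding L ?U F e"
    using free_joint_embeddingD[OF fj substructure_on_in_age[OF st D] substructure_on_in_age[OF st B]]
    by (auto simp: age_def)
  have U: "carrier ?U = D <+> B"
    by (simp add: disj_union_def substructure_on_def)
  have inj: "inj_on e (D <+> B)" and img: "e ` (D <+> B) \<subseteq> carrier F"
    using e U by (auto simp: embedding_def)
  have rel_e: "map e ys \<in> rel F r \<longleftrightarrow> ys \<in> rel ?U r"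
    if "r \<in> syms L" "set ys \<subseteq> D <+> B" "length ys = arity L r" for r ys
    using e that unfolding embedding_def U tuples_def by blast
  \<comment> \<open>The empty tuple is an image under both injections; this does no harm, as a
    nullary relation holds in either summand iff it holds in \<open>F\<close>.\<close>
  have Inl: "map Inl xs \<in> rel ?U r \<longleftrightarrow> xs \<in> rel F r" if "set xs \<subseteq> D" for xs r
  proof -
    have "\<not> (\<exists>ys. map Inl xs = map Inr ys) \<or> xs = []" by (cases xs) auto
    thus ?thesis
      using that unfolding rel_disj_union by (auto simp: substructure_on_def inj_map_eq_map)
  qed
  have Inr: "map Inr xs \<in> rel ?U r \<longleftrightarrow> xs \<in> rel F r" if "set xs \<subseteq> B" for xs r
  proof -
    have "\<not> (\<exists>ys. map Inr xs = map Inl ys) \<or> xs = []" by (cases xs) auto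
    thus ?thesis
      using that unfolding rel_disj_union by (auto simp: substructure_on_def inj_map_eq_map)
  qed
  obtain g where g: "g \<in> carrier (Aut L F)" "\<And>a. a \<in> D \<Longrightarrow> g a = e (Inl a)"
  proof (rule partial_embedding_extends[OF uh D])
    show "(\<lambda>a. e (Inl a)) ` D \<subseteq> carrier F" using img by auto
    show "inj_on (\<lambda>a. e (Inl a)) D"
      using inj by (auto simp: inj_on_def)
    show "map (\<lambda>a. e (Inl a)) xs \<in> rel F r \<longleftrightarrow> xs \<in> rel F r"
      if "r \<in> syms L" "set xs \<subseteq> D" "length xs = arity L r" for r xs
      using rel_e[of r "map Inl xs"] Inl[OF that(2)] that by (auto simp: o_def)
  qed blast
  obtain k where k: "k \<in> carrier (Aut L F)" "\<And>a. a \<in> B \<Longrightarrow> k a = e (Inr a)"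
  proof (rule partial_embedding_extends[OF uh B])
    show "(\<lambda>a. e (Inr a)) ` B \<subseteq> carrier F" using img by auto
    show "inj_on (\<lambda>a. e (Inr a)) B"
      using inj by (auto simp: inj_on_def)
    show "map (\<lambda>a. e (Inr a)) xs \<in> rel F r \<longleftrightarrow> xs \<in> rel F r"
      if "r \<in> syms L" "set xs \<subseteq> B" "length xs = arity L r" for r xs
      using rel_e[of r "map Inr xs"] Inr[OF that(2)] that by (auto simp: o_def)
  qed blast
  define h where "h = inv\<^bsub>Aut L F\<^esub> g \<otimes>\<^bsub>Aut L F\<^esub> k"
  have h: "h \<in> carrier (Aut L F)"
    by (simp add: h_def Aut_mult_closed Aut_inv_closed g(1) k(1))
  have gh: "g (h b) = e (Inr b)" if "b \<in> B" for b
    using that B(2) k(1) g(1)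
    by (simp add: h_def Aut_mult Aut_inv_closed Aut_apply_inv Aut_closed subset_iff flip: k(2))
  have "D \<inter> h ` B = {}"
  proof (rule ccontr)
    assume "D \<inter> h ` B \<noteq> {}"
    then obtain b where "b \<in> B" "h b \<in> D" by blast
    hence "e (Inl (h b)) = e (Inr b)" using g(2) gh by metis
    thus False
      using inj_onD[OF inj, of "Inl (h b)" "Inr b"] \<open>b \<in> B\<close> \<open>h b \<in> D\<close> by auto
  qed
  moreover have "set xs \<subseteq> D \<or> set xs \<subseteq> h ` B"
    if r: "r \<in> syms L" "xs \<in> rel F r" and xs: "set xs \<subseteq> D \<union> h ` B" for r xs
  proof -
    \<comment> \<open>The points \<open>w\<close> lift the tuple through \<open>e\<close> to the
      disjoint union, where a related tuple comes from one summand.\<close>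
    have "\<exists>w. w \<in> D <+> B \<and> g x = e w \<and> (isl w \<longrightarrow> x \<in> D) \<and> (\<not> isl w \<longrightarrow> x \<in> h ` B)"
      if "x \<in> set xs" for x
    proof (cases "x \<in> D")
      case True
      thus ?thesis using g(2) by (intro exI[of _ "Inl x"]) auto
    next
      case False
      then obtain b where "b \<in> B" "x = h b" using xs \<open>x \<in> set xs\<close> by blast
      thus ?thesis using gh by (intro exI[of _ "Inr b"]) auto
    qed
    then obtain w where w: "\<And>x. x \<in> set xs \<Longrightarrow> w x \<in> D <+> B \<and> g x = e (w x) \<and>
        (isl (w x) \<longrightarrow> x \<in> D) \<and> (\<not> isl (w x) \<longrightarrow> x \<in> h ` B)"
      by metis
    have sub: "set xs \<subseteq> carrier F" using rel_set_subset[OF st r] .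
    have len: "length xs = arity L r" using st r by (auto simp: is_structure_def tuples_def)
    have "map g xs \<in> rel F r"
      using Aut_rel[OF st g(1) r(1) sub] r(2) by simp
    moreover have "map g xs = map e (map w xs)" using w by simp
    ultimately have "map w xs \<in> rel ?U r"
      using rel_e[of r "map w xs"] r(1) w len by auto
    then consider ys where "map w xs = map Inl ys" | ys where "map w xs = map Inr ys"
      unfolding rel_disj_union by blast
    thus ?thesis
    proof cases
      case (1 ys)
      have "isl (w x)" if "x \<in> set xs" for x
        using arg_cong[OF 1, of set] that by (metis imageE imageI list.set_map sum.disc(1))
      thus ?thesis using w by blast
    next
      case (2 ys)
      have "\<not> isl (w x)" if "x \<in> set xs" for x
        using arg_cong[OF 2, of set] that by (metis imageE imageI list.set_map sum.disc(2))
      thus ?thesis using w by blast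
    qed
  qed
  ultimately show thesis using that h by blast
qed

text \<open>Each new copy is taken free over the union of the earlier ones. As tuples are finite,
  each one drawn from the copies lies in an initial segment, so the infinite family is free.\<close>

lemma free_copies:
  assumes F: "fraisse_structure L F" and fj: "free_joint_embedding L F"
    and B: "finite B" "B \<subseteq> carrier F"
  obtains h :: "nat \<Rightarrow> 'a \<Rightarrow> 'a" where "\<And>k. h k \<in> carrier (Aut L F)"
    "\<And>J. free_family L F (\<lambda>k. h k ` B) J"
proof -
  define free where "free D h \<longleftrightarrow> h \<in> carrier (Aut L F) \<and> D \<inter> h ` B = {} \<and>
    (\<forall>r\<in>syms L. \<forall>xs\<in>rel F r. set xs \<subseteq> D \<union> h ` B \<longrightarrow> set xs \<subseteq> D \<or> set xs \<subseteq> h ` B)" for D h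
  have ex: "\<exists>h. free D h" if "finite D" "D \<subseteq> carrier F" for D
    using free_copy[OF F fj that B] unfolding free_def by metis
  \<comment> \<open>A state pairs the set used so far with the next \<open>h\<close>, free over it.
    The clause at 0 starts from the empty set, so the set at stage n is exactly the union of the
    first n copies.\<close>
  define P where "P n s \<longleftrightarrow> finite (fst s) \<and> fst s \<subseteq> carrier F \<and> free (fst s) (snd s) \<and>
    (n = (0::nat) \<longrightarrow> fst s = {})" for n s
  have "\<exists>s. \<forall>n. P n (s n) \<and> fst (s (Suc n)) = fst (s n) \<union> snd (s n) ` B"
  proof (rule dependent_nat_choice)
    obtain h where "free {} h" using ex[of "{}"] by auto
    thus "\<exists>s. P 0 s" by (intro exI[of _ "({}, h)"]) (simp add: P_def)
  next
    fix s n assume s: "P n s"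
    let ?D = "fst s \<union> snd s ` B"
    have D: "finite ?D" "?D \<subseteq> carrier F"
      using s B Aut_closed[of "snd s" L F] by (auto simp: P_def free_def)
    from ex[OF this] obtain h where "free ?D h" ..
    thus "\<exists>t. P (Suc n) t \<and> fst t = fst s \<union> snd s ` B"
      using D by (intro exI[of _ "(?D, h)"]) (simp add: P_def)
  qed
  then obtain s where s: "\<forall>n. P n (s n) \<and> fst (s (Suc n)) = fst (s n) \<union> snd (s n) ` B" ..
  hence P: "P n (s n)" and Suc: "fst (s (Suc n)) = fst (s n) \<union> snd (s n) ` B" for n
    by simp_all
  define h where "h n = snd (s n)" for n
  have D: "fst (s n) = (\<Union>k<n. h k ` B)" for n
  proof (induction n)
    case 0
    show ?case using P[of 0] by (simp add: P_def)
  qed (auto simp: Suc h_def lessThan_Suc)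
  have free: "free (\<Union>k<n. h k ` B) (h n)" for n
    using P[of n] unfolding P_def D by (simp add: h_def)
  have disj: "h k ` B \<inter> h n ` B = {}" if "k < n" for k n
    using free[of n] that unfolding free_def by blast
  have conf: "xs = [] \<or> (\<exists>k<n. set xs \<subseteq> h k ` B)"
    if r: "r \<in> syms L" "xs \<in> rel F r" and "set xs \<subseteq> (\<Union>k<n. h k ` B)" for r xs n
    using that(3)
  proof (induction n)
    case (Suc n)
    have "(\<Union>k<Suc n. h k ` B) = (\<Union>k<n. h k ` B) \<union> h n ` B" by (auto simp: lessThan_Suc)
    hence "set xs \<subseteq> (\<Union>k<n. h k ` B) \<or> set xs \<subseteq> h n ` B"
      using free[of n, unfolded free_def, THEN conjunct2, THEN conjunct2, rule_format, OF r]
        Suc.prems by simp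
    thus ?case
    proof
      assume "set xs \<subseteq> (\<Union>k<n. h k ` B)"
      from Suc.IH[OF this] show ?case by (meson less_SucI)
    qed (use lessI in blast)
  qed simp
  have "free_family L F (\<lambda>k. h k ` B) UNIV"
    unfolding free_family_def
  proof (intro conjI ballI impI)
    show "disjoint_family_on (\<lambda>k. h k ` B) UNIV"
      unfolding disjoint_family_on_def
    proof (intro ballI impI)
      fix k n :: nat assume "k \<noteq> n"
      then consider "k < n" | "n < k" by linarith
      thus "h k ` B \<inter> h n ` B = {}" 
        using disj[of k n] disj[of n k] by cases (simp_all add: Int_commute)
    qed
    fix r xs assume r: "r \<in> syms L" "xs \<in> rel F r" and xs: "set xs \<subseteq> (\<Union>k\<in>UNIV. h k ` B)"
    have "\<forall>x\<in>set xs. \<exists>k. x \<in> h k ` B"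
      using subsetD[OF xs] by (simp only: UN_iff) simp
    from bchoice[OF this] obtain i where i: "\<And>x. x \<in> set xs \<Longrightarrow> x \<in> h (i x) ` B" by auto
    \<comment> \<open>For the empty tuple \<open>Max\<close> is unspecified, but then there is no
      entry to bound.\<close>
    let ?n = "Suc (Max (i ` set xs))"
    have "i x < ?n" if "x \<in> set xs" for x
      using that by (simp add: le_imp_less_Suc)
    hence "set xs \<subseteq> (\<Union>k<?n. h k ` B)" using i by (meson UN_I lessThan_iff subsetI)
    from conf[OF r this] show "xs = [] \<or> (\<exists>k\<in>UNIV. set xs \<subseteq> h k ` B)" by (meson UNIV_I)
  qed
  hence "free_family L F (\<lambda>k. h k ` B) J" for J
    by (rule free_family_mono) simp
  moreover have "h k \<in> carrier (Aut L F)" for k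
    using free[of k] by (simp add: free_def)
  ultimately show thesis using that by blast
qed

text \<open>The union of the maps \<open>\<theta> k\<close> on the sets \<open>S k\<close> is a
  partial embedding: it keeps points in their blocks, and on both sides a related nonempty tuple
  stays in one block, where a single automorphism acts. Homogeneity extends it.\<close>

lemma glue_automorphisms:
  assumes F: "fraisse_structure L F" and C: "free_family L F C J"
    and J: "finite J" and S: "\<And>k. k \<in> J \<Longrightarrow> finite (S k)"
    and SC: "\<And>k. k \<in> J \<Longrightarrow> S k \<subseteq> C k" and CF: "\<And>k. k \<in> J \<Longrightarrow> C k \<subseteq> carrier F"
    and \<theta>: "\<And>k. k \<in> J \<Longrightarrow> \<theta> k \<in> carrier (Aut L F)" "\<And>k. k \<in> J \<Longrightarrow> \<theta> k ` S k \<subseteq> C k"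
  obtains p where "p \<in> carrier (Aut L F)" "\<And>k a. k \<in> J \<Longrightarrow> a \<in> S k \<Longrightarrow> p a = \<theta> k a"
proof -
  have st: "is_structure L F" and uh: "ultrahomogeneous L F"
    using F by (simp_all add: fraisse_structure_def)
  let ?S = "\<Union>k\<in>J. S k"
  have disj: "k = l" if "k \<in> J" "l \<in> J" "a \<in> C k" "a \<in> C l" for k l a
    using free_familyD(1)[OF C that] .
  define i where "i a = (THE k. k \<in> J \<and> a \<in> C k)" for a
  have i: "i a = k" if "k \<in> J" "a \<in> C k" for a k
    unfolding i_def using that disj by (intro the_equality) blast+
  define f where "f a = \<theta> (i a) a" for a
  have f: "f a = \<theta> k a" if "k \<in> J" "a \<in> S k" for a k
    unfolding f_def using i[of k a] that SC by auto
  have fC: "f a \<in> C k \<longleftrightarrow> a \<in> C k" if a: "a \<in> ?S" and k: "k \<in> J" for a k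
  proof -
    obtain l where l: "l \<in> J" "a \<in> S l" using a by blast
    hence "a \<in> C l" "f a \<in> C l" using SC \<theta>(2) f by fastforce+
    thus ?thesis using disj k l(1) by blast
  qed
  have CS: "a \<in> S k" if a: "a \<in> ?S" and k: "k \<in> J" "a \<in> C k" for a k
    using that disj SC by blast
  obtain p where "p \<in> carrier (Aut L F)" "\<And>a. a \<in> ?S \<Longrightarrow> p a = f a"
  proof (rule partial_embedding_extends[OF uh])
    show "finite ?S" using J S by blast
    show SF: "?S \<subseteq> carrier F" using SC CF by blast
    show "f ` ?S \<subseteq> carrier F" using f \<theta>(2) CF by fastforce
    show "inj_on f ?S"
    proof (rule inj_onI)
      fix a b assume a: "a \<in> ?S" and b: "b \<in> ?S" and eq: "f a = f b"
      obtain k where k: "k \<in> J" "a \<in> S k" using a by blast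
      have "b \<in> S k" using fC[OF a k(1)] fC[OF b k(1)] CS[OF b k(1)] eq SC k by auto
      thus "a = b"
        using eq f k inj_onD[OF Aut_inj[OF \<theta>(1)[OF k(1)]]] SC CF by (metis subsetD)
    qed
    fix r xs assume r: "r \<in> syms L" and xs: "set xs \<subseteq> ?S"
    have fxs: "set (map f xs) \<subseteq> (\<Union>k\<in>J. C k)" using f \<theta>(2) xs by fastforce
    have xsC: "set xs \<subseteq> (\<Union>k\<in>J. C k)" using xs SC by blast
    have C_iff: "set (map f xs) \<subseteq> C k \<longleftrightarrow> set xs \<subseteq> C k" if "k \<in> J" for k
      using fC that xs by (auto simp: subset_iff)
    show "map f xs \<in> rel F r \<longleftrightarrow> xs \<in> rel F r"
    proof (cases "\<exists>k\<in>J. set xs \<subseteq> C k")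
      case True
      then obtain k where k: "k \<in> J" "set xs \<subseteq> C k" by blast
      have "f x = \<theta> k x" if "x \<in> set xs" for x
        using CS[of x k] f[of k x] k xs that by blast
      hence "map f xs = map (\<theta> k) xs" by simp
      moreover have "set xs \<subseteq> carrier F" using SF xs by blast
      ultimately show ?thesis using Aut_rel[OF st \<theta>(1)[OF k(1)] r, of xs] by metis
    next
      case False
      \<comment> \<open>A nonempty tuple contained in no block is unrelated, and by
        \<open>C_iff\<close> so is its image. What remains is \<open>[]\<close>, which
        \<open>map f\<close> fixes.\<close>
      hence "xs = []" if "xs \<in> rel F r \<or> map f xs \<in> rel F r"
        using free_familyD(2)[OF C r _ fxs] free_familyD(2)[OF C r _ xsC] C_iff that
        by (metis map_is_Nil_conv)
      thus ?thesis by auto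
    qed
  qed blast
  thus thesis using that f by (metis UN_I)
qed


section \<open>Null flows\<close>

lemma independence_setI:
  assumes fl: "flow G T X \<phi>" and I: "I \<subseteq> carrier G"
    and ex: "\<And>J \<sigma>. finite J \<Longrightarrow> J \<subseteq> I \<Longrightarrow>
      \<exists>x\<in>topspace X. \<forall>j\<in>J. \<phi> j x \<in> (if \<sigma> j then A1 else A0)"
  shows "independence_set G X \<phi> A0 A1 I"
  unfolding independence_set_def
proof (intro conjI allI impI)
  interpret group_action G "topspace X" \<phi> using fl by (simp add: flow_def)
  fix J \<sigma> assume J: "finite J \<and> J \<subseteq> I"
  then obtain x where x: "x \<in> topspace X" "\<And>j. j \<in> J \<Longrightarrow> \<phi> j x \<in> (if \<sigma> j then A1 else A0)"
    using ex[of J \<sigma>] by blast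
  have "x \<in> \<phi> (inv\<^bsub>G\<^esub> j) ` (if \<sigma> j then A1 else A0)" if j: "j \<in> J" for j
  proof (rule image_eqI)
    show "x = \<phi> (inv\<^bsub>G\<^esub> j) (\<phi> j x)"
      using orbit_sym_aux[of j x "\<phi> j x"] j J I x(1) by auto
  qed (rule x(2)[OF j])
  thus "topspace X \<inter> (\<Inter>j\<in>J. \<phi> (inv\<^bsub>G\<^esub> j) ` (if \<sigma> j then A1 else A0)) \<noteq> {}"
    using x(1) by blast
qed (rule I)

lemma independence_set_mono:
  assumes I: "independence_set G X \<phi> A0 A1 I" and sub: "A0 \<subseteq> B0" "A1 \<subseteq> B1"
  shows "independence_set G X \<phi> B0 B1 I"
  unfolding independence_set_def
proof (intro conjI allI impI)
  show "I \<subseteq> carrier G" using I by (simp add: independence_set_def)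
  fix J \<sigma> assume "finite J \<and> J \<subseteq> I"
  with I have "topspace X \<inter> (\<Inter>j\<in>J. \<phi> (inv\<^bsub>G\<^esub> j) ` (if \<sigma> j then A1 else A0)) \<noteq> {}"
    unfolding independence_set_def by (elim conjE allE[of _ J] allE[of _ \<sigma>] impE) simp_all
  moreover have "topspace X \<inter> (\<Inter>j\<in>J. \<phi> (inv\<^bsub>G\<^esub> j) ` (if \<sigma> j then A1 else A0)) \<subseteq>
      topspace X \<inter> (\<Inter>j\<in>J. \<phi> (inv\<^bsub>G\<^esub> j) ` (if \<sigma> j then B1 else B0))"
    using sub by (intro Int_mono INT_anti_mono image_mono) auto
  ultimately show "topspace X \<inter> (\<Inter>j\<in>J. \<phi> (inv\<^bsub>G\<^esub> j) ` (if \<sigma> j then B1 else B0)) \<noteq> {}"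
    by (elim contrapos_nn) (simp only: subset_empty)
qed

text \<open>Compact Hausdorff spaces are completely regular, so a real function separates
  \<open>y\<close> from \<open>z\<close> and nullness denies that they form an IN-pair. The
  resulting bound on the size of independence sets excludes infinite ones.\<close>

lemma null_flow_separation:
  fixes X :: "'x topology"
  assumes null: "null_flow G T X \<phi>" and y: "y \<in> topspace X" and z: "z \<in> topspace X" "y \<noteq> z"
  obtains U V where "openin X U" "y \<in> U" "openin X V" "z \<in> V"
    "\<And>I. independence_set G X \<phi> U V I \<Longrightarrow> finite I"
proof -
  have "compact_space X" "Hausdorff_space X"
    using null by (simp_all add: null_flow_def flow_def)
  hence "completely_regular_space X" and "closedin X {z}"
    by (simp_all add: compact_Hausdorff_or_regular_imp_normal_space
        normal_imp_completely_regular_space closedin_Hausdorff_singleton z(1))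
  then obtain f :: "'x \<Rightarrow> real" where
    f: "continuous_map X (top_of_set {0..1}) f" "f y = 0" "f ` {z} \<subseteq> {1}"
    using y z(2) unfolding completely_regular_space_def by blast
  have "continuous_map X euclideanreal f" using f(1) by (rule continuous_map_into_fulltopology)
  moreover have "f y \<noteq> f z" using f(2,3) by simp
  ultimately have "\<not> IN_pair G X \<phi> y z"
    using null z(2) unfolding null_flow_def by blast
  then obtain U0 U1 n where U: "nbhd X y U0" "nbhd X z U1"
    and no: "\<And>I. independence_set G X \<phi> U0 U1 I \<Longrightarrow> \<not> (infinite I \<or> n \<le> card I)"
    using y z(1) unfolding IN_pair_def by blast
  then obtain U V where UV: "openin X U" "y \<in> U" "U \<subseteq> U0" "openin X V" "z \<in> V" "V \<subseteq> U1"
    unfolding nbhd_def by blast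
  show thesis
    using no[OF independence_set_mono[OF _ UV(3,6)]] by (intro that[OF UV(1,2,4,5)]) simp
qed

text \<open>Joint continuity at the identity and \<open>y\<close> gives a product neighbourhood,
  whose group factor contains the pointwise stabilizer of a finite set.\<close>

lemma flow_small_stabilizer:
  assumes fl: "flow (Aut L F) (pointwise_topology L F) X \<phi>" and U: "openin X U" "y \<in> U"
  obtains A W where "finite A" "A \<subseteq> carrier F" "openin X W" "y \<in> W"
    "\<And>v w. v \<in> carrier (Aut L F) \<Longrightarrow> (\<And>a. a \<in> A \<Longrightarrow> v a = a) \<Longrightarrow> w \<in> W \<Longrightarrow> \<phi> v w \<in> U"
proof -
  let ?P = "prod_topology (pointwise_topology L F) X"
  interpret group_action "Aut L F" "topspace X" \<phi> using fl by (simp add: flow_def)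
  interpret G: group "Aut L F" by (rule group_Aut)
  have y: "y \<in> topspace X" using U openin_subset by blast
  have "\<phi> \<one>\<^bsub>Aut L F\<^esub> y = y" using id_eq_one y by (metis restrict_apply')
  moreover have "openin ?P {p \<in> topspace ?P. (\<lambda>(g, x). \<phi> g x) p \<in> U}"
    using fl U(1) unfolding flow_def by (blast intro: openin_continuous_map_preimage)
  moreover have "(\<one>\<^bsub>Aut L F\<^esub>, y) \<in> topspace ?P"
    using y by (simp add: topspace_pointwise_topology)
  ultimately obtain V W where VW: "openin (pointwise_topology L F) V" "openin X W"
      "\<one>\<^bsub>Aut L F\<^esub> \<in> V" "y \<in> W" "V \<times> W \<subseteq> {p \<in> topspace ?P. (\<lambda>(g, x). \<phi> g x) p \<in> U}"
    using U(2) unfolding openin_prod_topology_alt by (smt (verit) case_prod_conv mem_Collect_eq)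
  obtain A where A: "finite A" "A \<subseteq> carrier F"
    "\<And>v. v \<in> carrier (Aut L F) \<Longrightarrow> (\<And>a. a \<in> A \<Longrightarrow> v a = a) \<Longrightarrow> v \<in> V"
    by (rule pointwise_topology_nbhd_one[OF VW(1,3)]) blast
  show thesis
  proof (rule that[OF A(1,2) VW(2,4)])
    fix v w assume "v \<in> carrier (Aut L F)" "\<And>a. a \<in> A \<Longrightarrow> v a = a" "w \<in> W"
    hence "(v, w) \<in> V \<times> W" using A(3) by simp
    thus "\<phi> v w \<in> U" using VW(5) by auto
  qed
qed

section \<open>Fixed points of null flows\<close>

lemma null_flow_fixed_point:
  assumes F: "fraisse_structure L F" and fj: "free_joint_embedding L F"
    and null: "null_flow (Aut L F) (pointwise_topology L F) X \<phi>"
  shows "\<exists>x\<in>topspace X. \<forall>g\<in>carrier (Aut L F). \<phi> g x = x"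
proof (rule ccontr)
  assume nofix: "\<not> ?thesis"
  let ?G = "Aut L F"
  have fl: "flow ?G (pointwise_topology L F) X \<phi>" using null by (simp add: null_flow_def)
  interpret group_action ?G "topspace X" \<phi> using fl by (simp add: flow_def)
  interpret G: group ?G by (rule group_Aut)
  \<comment> \<open>Bundles the local data at \<open>y\<close>, so that one use of choice selects
    them for all points. That \<open>g\<close> moves \<open>y\<close> is what makes the finiteness
    of independence sets available.\<close>
  define loc where "loc y g A U V W \<longleftrightarrow> g \<in> carrier ?G \<and> finite A \<and> A \<subseteq> carrier F \<and>
    openin X W \<and> y \<in> W \<and> (\<forall>I. independence_set ?G X \<phi> U V I \<longrightarrow> finite I) \<and>
    (\<forall>v\<in>carrier ?G. \<forall>w\<in>W. (\<forall>a\<in>A. v a = a) \<longrightarrow> \<phi> v w \<in> U \<and> \<phi> v (\<phi> g w) \<in> V)"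
    for y g A U V W
  have "\<exists>g A U V W. loc y g A U V W" if y: "y \<in> topspace X" for y
  proof -
    obtain g where g: "g \<in> carrier ?G" "\<phi> g y \<noteq> y" using nofix y by blast
    obtain U V where UV: "openin X U" "y \<in> U" "openin X V" "\<phi> g y \<in> V"
      "\<And>I. independence_set ?G X \<phi> U V I \<Longrightarrow> finite I"
      using null_flow_separation[OF null y flow_act[OF fl g(1) y]] g(2) by metis
    obtain A W where A: "finite A" "A \<subseteq> carrier F" "openin X W" "y \<in> W"
      "\<And>v w. v \<in> carrier ?G \<Longrightarrow> (\<And>a. a \<in> A \<Longrightarrow> v a = a) \<Longrightarrow> w \<in> W \<Longrightarrow> \<phi> v w \<in> U"
      using flow_small_stabilizer[OF fl UV(1,2)] by metis
    obtain A' W' where A': "finite A'" "A' \<subseteq> carrier F" "openin X W'" "\<phi> g y \<in> W'"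
      "\<And>v w. v \<in> carrier ?G \<Longrightarrow> (\<And>a. a \<in> A' \<Longrightarrow> v a = a) \<Longrightarrow> w \<in> W' \<Longrightarrow> \<phi> v w \<in> V"
      using flow_small_stabilizer[OF fl UV(3,4)] by metis
    let ?W = "W \<inter> {w \<in> topspace X. \<phi> g w \<in> W'}"
    have "openin X {w \<in> topspace X. \<phi> g w \<in> W'}"
      by (intro openin_continuous_map_preimage[OF continuous_map_flow_act[OF fl _ g(1)] A'(3)]
          topspace_pointwise_topology)
    hence "loc y g (A \<union> A') U V ?W"
      using g(1) UV(5) A A' y unfolding loc_def by blast
    thus ?thesis by blast
  qed
  then obtain g A U V W where loc: "\<And>y. y \<in> topspace X \<Longrightarrow> loc y (g y) (A y) (U y) (V y) (W y)"
    by metis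
  have g: "g y \<in> carrier ?G" and A: "finite (A y)" "A y \<subseteq> carrier F"
    and W: "openin X (W y)" "y \<in> W y"
    and UV: "\<And>I. independence_set ?G X \<phi> (U y) (V y) I \<Longrightarrow> finite I"
    and act: "\<And>v w. v \<in> carrier ?G \<Longrightarrow> w \<in> W y \<Longrightarrow> (\<And>a. a \<in> A y \<Longrightarrow> v a = a) \<Longrightarrow>
      \<phi> v w \<in> U y \<and> \<phi> v (\<phi> (g y) w) \<in> V y"
    if "y \<in> topspace X" for y
    using loc[OF that] unfolding loc_def by blast+
  obtain x where x: "x \<in> topspace X" using fl unfolding flow_def by blast
  have "\<exists>\<W>. finite \<W> \<and> \<W> \<subseteq> W ` topspace X \<and> topspace X \<subseteq> \<Union>\<W>"
  proof (rule compactinD)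
    show "compactin X (topspace X)"
      using fl by (simp add: flow_def compact_space_def)
  qed (use W in auto)
  then obtain Y where Y: "finite Y" "Y \<subseteq> topspace X" "topspace X \<subseteq> (\<Union>y\<in>Y. W y)"
    by (metis finite_subset_image)
  \<comment> \<open>On an empty carrier the group is trivial, so \<open>x\<close> would be
    fixed.\<close>
  obtain a0 where a0: "a0 \<in> carrier F"
  proof -
    have "h = (\<lambda>_. undefined)" if "carrier F = {}" "h \<in> carrier ?G" for h
      using that by (auto simp: Aut_def Bij_def)
    hence "carrier F = {} \<Longrightarrow> \<phi> (g x) x = \<phi> \<one>\<^bsub>?G\<^esub> x" if "g x \<in> carrier ?G" for g
      using that G.one_closed by metis
    moreover have "\<phi> \<one>\<^bsub>?G\<^esub> x = x" using id_eq_one x by (metis restrict_apply')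
    ultimately show thesis using that nofix x by (metis equals0I)
  qed
  define A' where "A' = (\<Union>y\<in>Y. A y)"
  \<comment> \<open>\<open>a0\<close> makes \<open>B\<close> nonempty, so that disjoint copies of \<open>B\<close> come from different \<open>h k\<close>.\<close>
  define B where "B = insert a0 (A' \<union> (\<Union>y\<in>Y. (inv\<^bsub>?G\<^esub> g y) ` A'))"
  have AY: "finite (A y)" "A y \<subseteq> carrier F" if "y \<in> Y" for y
    using A Y(2) that by blast+
  have A': "finite A'" "A' \<subseteq> carrier F" using Y(1) AY by (auto simp: A'_def)
  have "(inv\<^bsub>?G\<^esub> g y) a \<in> carrier F" if "y \<in> Y" "a \<in> A'" for y a
    by (rule Aut_closed[OF Aut_inv_closed]) (use that g Y(2) A'(2) in blast)+
  hence B: "finite B" "B \<subseteq> carrier F"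
    using Y(1) A' a0 by (auto simp: B_def)
  obtain h where h: "\<And>k::nat. h k \<in> carrier ?G"
    and free: "\<And>J. free_family L F (\<lambda>k. h k ` B) J"
    using free_copies[OF F fj B] by metis
  let ?j = "\<lambda>k. inv\<^bsub>?G\<^esub> h k"
  have j: "?j k \<in> carrier ?G" for k using h by simp
  have "\<exists>y\<in>Y. \<phi> (?j k) x \<in> W y" for k
    using flow_act[OF fl j x] Y(3) by blast
  hence "\<exists>y\<in>Y. infinite {k\<in>UNIV. \<phi> (?j k) x \<in> W y}"
    using Y(1) by (intro pigeonhole_infinite_rel) auto
  then obtain y where y: "y \<in> Y" and inf: "infinite {k. \<phi> (?j k) x \<in> W y}" by auto
  define K where "K = {k. \<phi> (?j k) x \<in> W y}"
  have yX: "y \<in> topspace X" using y Y by blast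
  \<comment> \<open>Needed for infinitely many indices to give an infinite independence set. If
    \<open>h k = h l\<close>, both blocks contain the point \<open>h k a0\<close>.\<close>
  have "inj ?j"
  proof (rule injI)
    fix k l assume "?j k = ?j l"
    hence "h k = h l" using h by (metis G.inv_inv)
    thus "k = l"
      using free_familyD(1)[OF free[of UNIV], of k l "h k a0"] by (simp add: B_def)
  qed
  hence "infinite (?j ` K)"
    using inf unfolding K_def by (meson finite_imageD inj_on_subset subset_UNIV)
  moreover have "independence_set ?G X \<phi> (U y) (V y) (?j ` K)"
  proof (rule independence_setI[OF fl])
    show "?j ` K \<subseteq> carrier ?G" using j by blast
    fix J' and \<sigma> assume "finite J'" "J' \<subseteq> ?j ` K"
    then obtain J where J: "J \<subseteq> K" "finite J" "J' = ?j ` J" by (meson finite_subset_image)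
    \<comment> \<open>The pattern \<open>\<sigma>\<close> asks for \<open>V y\<close> when true and
      \<open>U y\<close> when false; accordingly the point is moved by \<open>g y\<close> or left in
      place.\<close>
    define z where "z k = (if \<sigma> (?j k) then g y else \<one>\<^bsub>?G\<^esub>)" for k
    have z: "z k \<in> carrier ?G" for k using g[OF yX] by (simp add: z_def)
    have zA: "(inv\<^bsub>?G\<^esub> z k) a \<in> B" if "a \<in> A'" for k a
      using that y A'(2) Aut_one[of a F L] by (auto simp: z_def B_def)
    \<comment> \<open>The inverse of \<open>z k\<close>, conjugated to the \<open>k\<close>-th copy.
      It maps the copy of \<open>A'\<close> into the copy of \<open>B\<close>, since
      \<open>B\<close> contains \<open>A'\<close> and its translate by the inverse of
      \<open>g y\<close>.\<close>
    define \<theta> where "\<theta> k = h k \<otimes>\<^bsub>?G\<^esub> (inv\<^bsub>?G\<^esub> z k \<otimes>\<^bsub>?G\<^esub> ?j k)" for k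
    have \<theta>: "\<theta> k \<in> carrier ?G" for k using h z by (simp add: \<theta>_def)
    have \<theta>_h: "\<theta> k (h k a) = h k ((inv\<^bsub>?G\<^esub> z k) a)" if "a \<in> A'" for k a
      using subsetD[OF A'(2) that] Aut_closed[OF h subsetD[OF A'(2) that]] h z
      by (simp add: \<theta>_def Aut_mult Aut_inv_apply)
    obtain p where p: "p \<in> carrier ?G" "\<And>k a. k \<in> J \<Longrightarrow> a \<in> h k ` A' \<Longrightarrow> p a = \<theta> k a"
    proof (rule glue_automorphisms[OF F free, of J "\<lambda>k. h k ` A'" \<theta>])
      show "\<theta> k ` h k ` A' \<subseteq> h k ` B" for k using \<theta>_h zA by auto
      show "h k ` A' \<subseteq> h k ` B" for k by (auto simp: B_def)
      show "h k ` B \<subseteq> carrier F" for k using B(2) Aut_closed[OF h] by blast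
    qed (use J A' \<theta> in auto)
    let ?q = "inv\<^bsub>?G\<^esub> p"
    have q: "?q \<in> carrier ?G" using p(1) by simp
    have "\<phi> (?j k) (\<phi> ?q x) \<in> (if \<sigma> (?j k) then V y else U y)" if k: "k \<in> J" for k
    proof -
      \<comment> \<open>Chosen so that \<open>v\<close> times \<open>z k\<close> times
        \<open>?j k\<close> is \<open>?j k\<close> times \<open>?q\<close>; that \<open>v\<close>
        fixes \<open>A'\<close> is the gluing condition on \<open>p\<close>, rewritten.\<close>
      define v where "v = ?j k \<otimes>\<^bsub>?G\<^esub> (?q \<otimes>\<^bsub>?G\<^esub> (h k \<otimes>\<^bsub>?G\<^esub> inv\<^bsub>?G\<^esub> z k))"
      have v: "v \<in> carrier ?G" using h z q by (simp add: v_def)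
      have "v a = a" if a: "a \<in> A'" for a
      proof -
        have aF: "a \<in> carrier F" using a A'(2) by blast
        have "p (h k a) = h k ((inv\<^bsub>?G\<^esub> z k) a)" using p(2)[OF k] a \<theta>_h by simp
        hence "?q (h k ((inv\<^bsub>?G\<^esub> z k) a)) = h k a"
          using Aut_inv_apply[OF p(1) Aut_closed[OF h aF]] by metis
        thus ?thesis
          using h z q aF Aut_closed[OF G.inv_closed[OF z] aF]
          by (simp add: v_def Aut_mult Aut_inv_apply Aut_closed[OF h])
      qed
      hence "v a = a" if "a \<in> A y" for a using that y by (auto simp: A'_def)
      moreover have "\<phi> (?j k) x \<in> W y" using k J(1) by (auto simp: K_def)
      ultimately have "\<phi> v (\<phi> (z k) (\<phi> (?j k) x)) \<in> (if \<sigma> (?j k) then V y else U y)"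
        using act[OF yX v] id_eq_one flow_act[OF fl j x]
        by (simp add: z_def) (metis restrict_apply')
      moreover have "v \<otimes>\<^bsub>?G\<^esub> (z k \<otimes>\<^bsub>?G\<^esub> ?j k) = ?j k \<otimes>\<^bsub>?G\<^esub> ?q"
      proof -
        have "inv\<^bsub>?G\<^esub> z k \<otimes>\<^bsub>?G\<^esub> (z k \<otimes>\<^bsub>?G\<^esub> ?j k) = ?j k"
          using z j by (simp flip: G.m_assoc)
        thus ?thesis using z j h q by (simp add: v_def G.m_assoc)
      qed
      ultimately show ?thesis
        by (metis flow_act_mult[OF fl z j x]
            flow_act_mult[OF fl v G.m_closed[OF z j] x] flow_act_mult[OF fl j q x])
    qed
    thus "\<exists>x\<in>topspace X. \<forall>j\<in>J'. \<phi> j x \<in> (if \<sigma> j then V y else U y)"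
      using J(3) flow_act[OF fl q x] by blast
  qed
  ultimately show False using UV[OF yX] by blast
qed

section \<open>Minimal null flows\<close>

lemma minimal_null_flow_singleton:
  assumes F: "fraisse_structure L F" and fj: "free_joint_embedding L F"
    and mn: "minimal_null_flow (Aut L F) (pointwise_topology L F) X \<phi>"
  shows "\<exists>x. topspace X = {x} \<and> (\<forall>g\<in>carrier (Aut L F). \<phi> g x = x)"
proof -
  have min: "minimal_flow (Aut L F) (pointwise_topology L F) X \<phi>"
    and null: "null_flow (Aut L F) (pointwise_topology L F) X \<phi>"
    using mn by (simp_all add: minimal_null_flow_def)
  obtain x where x: "x \<in> topspace X" "\<forall>g\<in>carrier (Aut L F). \<phi> g x = x"
    using null_flow_fixed_point[OF F fj null] by blast
  \<comment> \<open>A fixed point is a closed invariant set, so minimality makes it the whole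
    space.\<close>
  have "closedin X {x}"
    using null x(1) by (simp add: null_flow_def flow_def closedin_Hausdorff_singleton)
  moreover have "\<forall>g\<in>carrier (Aut L F). \<phi> g ` {x} \<subseteq> {x}" using x(2) by simp
  ultimately have "{x} = topspace X"
    using min[unfolded minimal_flow_def, THEN conjunct2, rule_format, of "{x}"] by simp
  thus ?thesis using x(2) by metis
qed

text \<open>The identity is restricted to \<open>{m}\<close> because elements of
  \<open>BijGroup\<close> are extensional. The action is the second projection, hence continuous for
  every \<open>T\<close>.\<close>

lemma minimal_null_flow_point:
  assumes "group G"
  shows "minimal_null_flow G T (discrete_topology {m}) (\<lambda>g. \<lambda>x\<in>{m}. x)"
proof -
  let ?\<phi> = "\<lambda>g. \<lambda>x\<in>{m}. x" and ?X = "discrete_topology {m}"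
  have "?\<phi> \<in> hom G (BijGroup {m})"
    by (auto simp: hom_def BijGroup_def Bij_def bij_betw_def compose_def)
  hence "group_action G {m} ?\<phi>"
    using assms by (intro group_action.intro group_hom.intro group_hom_axioms.intro group_BijGroup)
  moreover have "continuous_map (prod_topology T ?X) ?X (\<lambda>(g, x). ?\<phi> g x)"
    by (rule continuous_map_eq[OF continuous_map_snd]) auto
  ultimately have "flow G T ?X ?\<phi>"
    by (simp add: flow_def compact_space_discrete_topology Hausdorff_space_discrete_topology)
  thus ?thesis
    by (auto simp: minimal_null_flow_def minimal_flow_def null_flow_def IN_pair_def)
qed

text \<open>The middle conjunct supplies a universal minimal null flow, so that the last one speaks
  of an existing object; the outer conjuncts cover flows on points of any type.\<close>

theorem theorem3p7:
  fixes L :: "'r language" and F :: "('a, 'r) relstruct"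
  assumes "fraisse_structure L F"
    and "free_joint_embedding L F"
  shows "(\<forall>(X :: 'x topology) \<phi>. null_flow (Aut L F) (pointwise_topology L F) X \<phi> \<longrightarrow>
            (\<exists>x\<in>topspace X. \<forall>g\<in>carrier (Aut L F). \<phi> g x = x)) \<and>
         (\<exists>(M :: ('a \<Rightarrow> 'a) set set topology) \<phi>.
            universal_minimal_null_flow (Aut L F) (pointwise_topology L F) M \<phi>) \<and>
         (\<forall>(M :: 'x topology) \<phi>.
            universal_minimal_null_flow (Aut L F) (pointwise_topology L F) M \<phi> \<longrightarrow>
            (\<exists>m. topspace M = {m}))"
proof (intro conjI allI impI)
  let ?G = "Aut L F" and ?T = "pointwise_topology L F"
  show "\<exists>x\<in>topspace X. \<forall>g\<in>carrier ?G. \<phi> g x = x" if "null_flow ?G ?T X \<phi>"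
    for X :: "'x topology" and \<phi>
    using null_flow_fixed_point[OF assms that] .
  show "\<exists>m. topspace M = {m}" if "universal_minimal_null_flow ?G ?T M \<phi>"
    for M :: "'x topology" and \<phi>
  proof -
    have "minimal_null_flow ?G ?T M \<phi>"
      using that unfolding universal_minimal_null_flow_def by (rule conjunct1)
    from minimal_null_flow_singleton[OF assms this] show ?thesis by blast
  qed
  \<comment> \<open>A one-point model; the choice of \<open>{}\<close> is arbitrary. Every
    competitor is a single fixed point, so the constant map is the required surjection.\<close>
  let ?M = "discrete_topology {{}} :: ('a \<Rightarrow> 'a) set set topology" and ?\<phi> = "\<lambda>g. \<lambda>x\<in>{{}}. x"
  have "\<exists>h. flow_map ?G ?M ?\<phi> Y \<psi> h \<and> h ` topspace ?M = topspace Y"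
    if Y: "minimal_null_flow ?G ?T Y \<psi>" for Y :: "('a \<Rightarrow> 'a) set set topology" and \<psi>
  proof -
    from minimal_null_flow_singleton[OF assms Y] obtain m
      where "topspace Y = {m}" "\<forall>g\<in>carrier ?G. \<psi> g m = m" by (elim exE conjE)
    thus ?thesis by (intro exI[of _ "\<lambda>_. m"]) (simp add: flow_map_def)
  qed
  moreover have "minimal_null_flow ?G ?T ?M ?\<phi>"
    by (rule minimal_null_flow_point[OF group_Aut])
  ultimately have "universal_minimal_null_flow ?G ?T ?M ?\<phi>"
    unfolding universal_minimal_null_flow_def by simp
  thus "\<exists>(M :: ('a \<Rightarrow> 'a) set set topology) \<phi>. universal_minimal_null_flow ?G ?T M \<phi>"
    by (intro exI)
qed

end
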